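(* Let $N\geq2$, $1\leq d<N$ be integers, $0<p<q\leq\infty$ and $s>\sigma_p$. Let $\Psi$ be an admissible function. Then there exists a function $f\in B_{p,q}^{(s,\Psi)}(\mathbb{R}^N)$ such that $$f(\cdot,x'')\notin B_{p,\infty}^{(s,\Psi)}(\mathbb{R}^d)\qquad\text{for a.e. } x''\in\mathbb{R}^{N-d}.$$
   Context: $\sigma_p:=N\left(\frac1p-1\right)_+$ with $x_+=\max\{0,x\}$. Points of $\mathbb{R}^N$ are written $(x',x'')$ with $x'\in\mathbb{R}^d$, $x''\in\mathbb{R}^{N-d}$, and $f(\cdot,x'')$ is the function $x'\mapsto f(x',x'')$ on $\mathbb{R}^d$. A real function $\Psi$ on $(0,1]$ is called admissible if it is positive and monotone on $(0,1]$ and $\Psi(2^{-j})\sim\Psi(2^{-2j})$ for all $j\in\mathbb{N}=\{0,1,2,\dots\}$, i.e. there are constants $0<c\le C$ with $c\,\Psi(2^{-2j})\leq\Psi(2^{-j})\leq C\,\Psi(2^{-2j})$ for all $j$. For $M\in\{1,2,\dots\}$ and $h\in\mathbb{R}^n$, $\Delta_h^Mf(x)=\sum_{j=0}^M(-1)^{M-j}\binom{M}{j}f(x+hj)$. Let $n\geq1$, $0<p,q\leq\infty$, $s>n(\frac1p-1)_+$ with $s>0$, and let $M>s$ be an integer. For $\Psi$ admissible, the Besov space of generalized smoothness $B_{p,q}^{(s,\Psi)}(\mathbb{R}^n)$ is the set of all $f\in L^p(\mathbb{R}^n)$ with $$\left(\int_0^1\sup_{|h|\leq t}\|\Delta_h^Mf\|_{L^p(\mathbb{R}^n)}^q\frac{\Psi(t)^q}{t^{1+sq}}\,\mathrm{d}t\right)^{1/q}<\infty,$$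 which for $q=\infty$ means $\sup_{0<t\leq1}t^{-s}\Psi(t)\sup_{|h|\leq t}\|\Delta_h^Mf\|_{L^p(\mathbb{R}^n)}<\infty$. Different choices of $M>s$ give the same space. *)

theory Defs
  imports "HOL-Analysis.Analysis" "HOL-Probability.Essential_Supremum"
begin

definition sigma_exp :: "nat \<Rightarrow> ennreal \<Rightarrow> real" where
  "sigma_exp n p = real n * max 0 (enn2real (1 / p) - 1)"

definition admissible :: "(real \<Rightarrow> real) \<Rightarrow> bool" where
  "admissible \<Psi> \<longleftrightarrow>
     (\<forall>t\<in>{0<..1}. 0 < \<Psi> t) \<and>
     (mono_on {0<..1} \<Psi> \<or> antimono_on {0<..1} \<Psi>) \<and>
     (\<exists>c C. 0 < c \<and> c \<le> C \<and>
        (\<forall>j::nat. c * \<Psi> ((1/2) ^ (2 * j)) \<le> \<Psi> ((1/2) ^ j) \<and>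
                 \<Psi> ((1/2) ^ j) \<le> C * \<Psi> ((1/2) ^ (2 * j))))"

definition diff_op :: "nat \<Rightarrow> 'a::real_vector \<Rightarrow> ('a \<Rightarrow> real) \<Rightarrow> 'a \<Rightarrow> real" where
  "diff_op M h f x = (\<Sum>j\<le>M. (-1) ^ (M - j) * real (M choose j) * f (x + real j *\<^sub>R h))"

text \<open>Powers of extended nonnegative numbers with an exponent \<open>0 < r < \<infinity>\<close>.\<close>

definition ennpow :: "ennreal \<Rightarrow> real \<Rightarrow> ennreal" where
  "ennpow x r = (if x = \<infinity> then \<infinity> else ennreal (enn2real x powr r))"

text \<open>The exponents \<open>p\<close> and \<open>q\<close> below range over \<open>(0, \<infinity>]\<close>; membership in \<open>L\<^sup>p\<close> is
  with respect to the completed Lebesgue measure.\<close>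

definition Lp_norm :: "ennreal \<Rightarrow> ('a::euclidean_space \<Rightarrow> real) \<Rightarrow> ennreal" where
  "Lp_norm p f =
     (if p = \<infinity> then esssup lebesgue (\<lambda>x. ennreal \<bar>f x\<bar>)
      else ennpow (\<integral>\<^sup>+x. ennreal (\<bar>f x\<bar> powr enn2real p) \<partial>lebesgue) (1 / enn2real p))"

definition Lp_space :: "ennreal \<Rightarrow> ('a::euclidean_space \<Rightarrow> real) set" where
  "Lp_space p = {f. f \<in> borel_measurable lebesgue \<and> Lp_norm p f < \<infinity>}"

definition besov_seminorm ::
  "nat \<Rightarrow> ennreal \<Rightarrow> ennreal \<Rightarrow> real \<Rightarrow> (real \<Rightarrow> real) \<Rightarrow> ('a::euclidean_space \<Rightarrow> real) \<Rightarrow> ennreal" where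
  "besov_seminorm M p q s \<Psi> f =
     (if q = \<infinity>
      then (SUP t\<in>{0<..1}. ennreal (t powr (- s) * \<Psi> t) *
              (SUP h\<in>cball 0 t. Lp_norm p (diff_op M h f)))
      else ennpow
             (\<integral>\<^sup>+t\<in>{0<..1}. (SUP h\<in>cball 0 t. ennpow (Lp_norm p (diff_op M h f)) (enn2real q)) *
                ennreal (\<Psi> t powr enn2real q / t powr (1 + s * enn2real q)) \<partial>lebesgue)
             (1 / enn2real q))"

text \<open>The order \<open>M\<close> of the differences stays a parameter. The intended range is
  \<open>s > 0\<close>, \<open>s > sigma_exp DIM('a) p\<close> and \<open>M > s\<close>; there, different \<open>M\<close> give the same space.
  Points \<open>(x', x'')\<close> of \<open>N\<close>-space are pairs in the Euclidean space \<open>(real^'d) \<times> (real^'e)\<close>,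
  with \<open>d = CARD('d)\<close> and \<open>N - d = CARD('e)\<close>; its norm is the Euclidean one.\<close>

definition besov_space ::
  "nat \<Rightarrow> ennreal \<Rightarrow> ennreal \<Rightarrow> real \<Rightarrow> (real \<Rightarrow> real) \<Rightarrow> ('a::euclidean_space \<Rightarrow> real) set" where
  "besov_space M p q s \<Psi> = {f \<in> Lp_space p. besov_seminorm M p q s \<Psi> f < \<infinity>}"

end

theory Submission
  imports Defs
begin

text \<open>
  The function is a superposition of tiles \<open>f = (\<Sum>k. c k * tile k)\<close>, one for every scale \<open>(1/2) ^ k\<close>.
  A tile is a product of fixed bumps: in \<open>x'\<close> it has side \<open>(1/2) ^ k\<close> and sits at a place of its own,
  in \<open>x''\<close> it has the possibly much larger half-side \<open>r k\<close> and the centre \<open>z k\<close>. With the normalisation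
  \<open>c k \<approx> a k * 2 powr (- k * (s - d / p)) / \<Psi> ((1/2) ^ k)\<close>, tile \<open>k\<close> has Besov seminorm about
  \<open>b k = a k * r k powr ((N - d) / p)\<close>, whereas its slice at a point \<open>x''\<close> of the core of its
  \<open>x''\<close>-support has seminorm about \<open>a k\<close>. A slice over a small set is cheap in \<open>L\<^sup>p\<close>, and this is
  exploited by making the tiles narrow in \<open>x''\<close> and many.

  Different scales hardly interact in the Besov norm, so \<open>f\<close> has finite norm as soon as
  \<open>b\<close> lies in \<open>\<ell>\<^sup>q\<close>. As \<open>q > p\<close>, this does not force the volumes \<open>r k ^ (N - d)\<close> to be summable:
  there are cubes that cover every \<open>x''\<close> infinitely often, with unbounded heights \<open>a k\<close> over
  each \<open>x''\<close>, and still \<open>b \<in> \<ell>\<^sup>q\<close> (lemma \<open>recurrent_covering\<close>). Then no slice of \<open>f\<close> has a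
  finite seminorm with \<open>q = \<infinity>\<close>; the exceptional set is even empty.

  The upper bound rests on three facts. A tile has differences of order \<open>m > s\<close> of size
  \<open>min 1 (2 ^ k * norm h) ^ m\<close> (\<open>diff_op_tile_bound\<close>). Since the tiles have disjoint supports and a
  difference of order \<open>M\<close> sees at most \<open>M + 1\<close> of them at once, \<open>p\<close>-th powers of norms add up for all
  \<open>p > 0\<close> alike (\<open>nn_integral_diff_op_disjoint_sum\<close>). Finally \<open>\<Psi>\<close> varies more slowly than any power
  (\<open>admissible_growth\<close>), so the contributions of scale \<open>k\<close> at step length \<open>(1/2) ^ j\<close> decay
  geometrically in \<open>\<bar>j - k\<bar>\<close> (\<open>weighted_sum_bound\<close>). For the lower bound the step \<open>(1/2) ^ k\<close>
  separates the value of tile \<open>k\<close> from everything else in the slice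
  (\<open>nn_integral_diff_op_tile_sum_slice_ge\<close>).
\<close>

section \<open>Differences of functions with bounded derivatives\<close>

text \<open>
  Derivatives up to order \<open>m\<close>, the one of order \<open>i\<close> being bounded by \<open>K * L ^ i\<close>. The two
  parameters separate amplitude from frequency: products multiply the amplitudes at a common
  frequency, and an affine substitution changes only the frequency. The recursion on \<open>m\<close> lets
  all such rules be proved by one induction without higher derivatives or Leibniz sums.
\<close>

primrec derivs_bounded :: "nat \<Rightarrow> real \<Rightarrow> real \<Rightarrow> (real \<Rightarrow> real) \<Rightarrow> bool" where
  "derivs_bounded 0 K L g \<longleftrightarrow> (\<forall>x. \<bar>g x\<bar> \<le> K)"
| "derivs_bounded (Suc m) K L g \<longleftrightarrow> (\<forall>x. \<bar>g x\<bar> \<le> K) \<and>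
     (\<exists>g'. (\<forall>x. (g has_real_derivative g' x) (at x)) \<and> derivs_bounded m (K * L) L g')"

lemma derivs_bounded_SucI:
  assumes "\<And>x. \<bar>g x\<bar> \<le> K" "\<And>x. (g has_real_derivative g' x) (at x)" "derivs_bounded m (K * L) L g'"
  shows "derivs_bounded (Suc m) K L g"
  using assms by auto

lemma derivs_bounded_abs_le: "derivs_bounded m K L g \<Longrightarrow> \<bar>g x\<bar> \<le> K"
  by (cases m) auto

lemma derivs_bounded_nonneg: "derivs_bounded m K L g \<Longrightarrow> 0 \<le> K"
  using derivs_bounded_abs_le[of m K L g 0] by linarith

lemma derivs_bounded_SucD: "derivs_bounded (Suc m) K L g \<Longrightarrow> derivs_bounded m K L g"
proof (induction m arbitrary: K g)
  case (Suc m)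
  then show ?case by (metis derivs_bounded.simps(2))
qed auto

lemma derivs_bounded_mono:
  assumes "derivs_bounded m K L g" "K \<le> K'" "0 \<le> L" "L \<le> L'"
  shows "derivs_bounded m K' L' g"
  using assms(1,2)
proof (induction m arbitrary: K K' g)
  case 0
  then show ?case by (auto intro: order_trans)
next
  case (Suc m)
  then obtain g' where g': "\<forall>x. (g has_real_derivative g' x) (at x)" "derivs_bounded m (K * L) L g'"
    by auto
  have "0 \<le> K" using Suc.prems(1) by (rule derivs_bounded_nonneg)
  then have "K * L \<le> K' * L'"
    using Suc.prems(2) assms(3,4) by (intro mult_mono) auto
  with Suc g' show ?case by (auto intro: order_trans)
qed

lemma derivs_bounded_const:
  assumes "\<bar>c\<bar> \<le> K" "0 \<le> L"
  shows "derivs_bounded m K L (\<lambda>_. c)"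
  using assms(1)
proof (induction m arbitrary: K c)
  case (Suc m)
  have "derivs_bounded m (K * L) L (\<lambda>_. 0)"
    using Suc.prems assms(2) by (intro Suc.IH) auto
  then show ?case using Suc.prems by (intro derivs_bounded_SucI[where g' = "\<lambda>_. 0"]) auto
qed auto

lemma derivs_bounded_add:
  assumes "derivs_bounded m K L f" "derivs_bounded m K' L g"
  shows "derivs_bounded m (K + K') L (\<lambda>x. f x + g x)"
  using assms
proof (induction m arbitrary: K K' f g)
  case 0
  then show ?case by (auto intro: order_trans[OF abs_triangle_ineq] add_mono)
next
  case (Suc m)
  from Suc.prems obtain f' g' where *:
    "\<And>x. (f has_real_derivative f' x) (at x)" "derivs_bounded m (K * L) L f'"
    "\<And>x. (g has_real_derivative g' x) (at x)" "derivs_bounded m (K' * L) L g'"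
    by auto
  have "derivs_bounded m ((K + K') * L) L (\<lambda>x. f' x + g' x)"
    using Suc.IH[OF *(2,4)] by (simp add: algebra_simps)
  moreover have "\<forall>x. ((\<lambda>x. f x + g x) has_real_derivative f' x + g' x) (at x)"
    using *(1,3) by (auto intro: DERIV_add)
  moreover have "\<bar>f x + g x\<bar> \<le> K + K'" for x
    using derivs_bounded_abs_le[OF Suc.prems(1), of x] derivs_bounded_abs_le[OF Suc.prems(2), of x]
    by linarith
  ultimately show ?case by (intro derivs_bounded_SucI[where g' = "\<lambda>x. f' x + g' x"]) auto
qed

text \<open>
  By the product rule a derivative is a sum of two products, which costs a factor \<open>2\<close> per order.
\<close>

lemma derivs_bounded_mult:
  assumes "derivs_bounded m K L f" "derivs_bounded m K' L g"
  shows "derivs_bounded m (K * K' * 2 ^ m) L (\<lambda>x. f x * g x)"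
  using assms
proof (induction m arbitrary: K K' f g)
  case 0
  then show ?case by (auto simp: abs_mult intro!: mult_mono intro: order_trans[OF abs_ge_zero])
next
  case (Suc m)
  from Suc.prems obtain f' g' where *:
    "\<And>x. (f has_real_derivative f' x) (at x)" "derivs_bounded m (K * L) L f'"
    "\<And>x. (g has_real_derivative g' x) (at x)" "derivs_bounded m (K' * L) L g'"
    by auto
  have "derivs_bounded m ((K * L) * K' * 2 ^ m + K * (K' * L) * 2 ^ m) L (\<lambda>x. f' x * g x + f x * g' x)"
    using * Suc.prems by (intro derivs_bounded_add Suc.IH) (auto dest: derivs_bounded_SucD simp del: derivs_bounded.simps)
  then have "derivs_bounded m (K * K' * 2 ^ Suc m * L) L (\<lambda>x. f' x * g x + f x * g' x)"
    by (simp add: algebra_simps)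
  moreover have "\<forall>x. ((\<lambda>x. f x * g x) has_real_derivative f' x * g x + f x * g' x) (at x)"
    using *(1,3) by (auto intro!: derivative_eq_intros)
  moreover have "\<bar>f x * g x\<bar> \<le> K * K' * 2 ^ Suc m" for x
  proof -
    have "0 \<le> K" "0 \<le> K'" using Suc.prems derivs_bounded_nonneg by blast+
    then have "\<bar>f x * g x\<bar> \<le> K * K' * 1"
      using Suc.prems by (auto simp: abs_mult intro!: mult_mono)
    also have "\<dots> \<le> K * K' * 2 ^ Suc m"
      using \<open>0 \<le> K\<close> \<open>0 \<le> K'\<close> by (intro mult_left_mono one_le_power) auto
    finally show ?thesis .
  qed
  ultimately show ?case
    by (intro derivs_bounded_SucI[where g' = "\<lambda>x. f' x * g x + f x * g' x"]) auto
qed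

lemma derivs_bounded_cmult:
  assumes "derivs_bounded m K L g"
  shows "derivs_bounded m (\<bar>c\<bar> * K) L (\<lambda>x. c * g x)"
  using assms
proof (induction m arbitrary: K g)
  case 0
  then show ?case by (auto simp: abs_mult intro!: mult_left_mono)
next
  case (Suc m)
  from Suc.prems obtain g' where *:
    "\<And>x. (g has_real_derivative g' x) (at x)" "derivs_bounded m (K * L) L g'" by auto
  have "derivs_bounded m (\<bar>c\<bar> * K * L) L (\<lambda>x. c * g' x)"
    using Suc.IH[OF *(2)] by (simp add: mult.assoc)
  moreover have "\<forall>x. ((\<lambda>x. c * g x) has_real_derivative c * g' x) (at x)"
    using *(1) by (auto intro: DERIV_cmult)
  ultimately show ?case using derivs_bounded_abs_le[OF Suc.prems]
    by (intro derivs_bounded_SucI[where g' = "\<lambda>x. c * g' x"]) (auto simp: abs_mult intro!: mult_left_mono)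
qed

lemma derivs_bounded_affine:
  assumes "derivs_bounded m K L g"
  shows "derivs_bounded m K (L * \<bar>v\<bar>) (\<lambda>u. g (a + u * v))"
  using assms
proof (induction m arbitrary: K g)
  case (Suc m)
  from Suc.prems obtain g' where *:
    "\<And>x. (g has_real_derivative g' x) (at x)" "derivs_bounded m (K * L) L g'" by auto
  have "derivs_bounded m (\<bar>v\<bar> * (K * L)) (L * \<bar>v\<bar>) (\<lambda>u. v * g' (a + u * v))"
    by (intro derivs_bounded_cmult Suc.IH *(2))
  moreover have "((\<lambda>u. g (a + u * v)) has_real_derivative v * g' (a + u * v)) (at u)" for u
  proof -
    have "((\<lambda>u. a + u * v) has_real_derivative v) (at u)"
      by (auto intro!: derivative_eq_intros)
    from DERIV_chain2[OF *(1) this] show ?thesis by (simp add: mult.commute)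
  qed
  ultimately show ?case using derivs_bounded_abs_le[OF Suc.prems]
    by (intro derivs_bounded_SucI[where g' = "\<lambda>u. v * g' (a + u * v)"]) (auto simp: mult_ac)
qed auto

lemma derivs_bounded_prod:
  assumes "finite I" "\<And>i. i \<in> I \<Longrightarrow> derivs_bounded m K L (g i)" "0 \<le> L"
  shows "derivs_bounded m ((K * 2 ^ m) ^ card I) L (\<lambda>x. \<Prod>i\<in>I. g i x)"
  using assms(1,2)
proof (induction I)
  case empty
  then show ?case using assms(3) by (simp add: derivs_bounded_const)
next
  case (insert i I)
  have "derivs_bounded m (K * (K * 2 ^ m) ^ card I * 2 ^ m) L (\<lambda>x. g i x * (\<Prod>i\<in>I. g i x))"
    using insert by (intro derivs_bounded_mult) auto
  then show ?case using insert by (simp add: mult_ac)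
qed

text \<open>
  A unit difference costs one order of smoothness and gains one factor \<open>L\<close>, by the mean value
  theorem. Iterating it bounds the differences of order \<open>m\<close> by \<open>L ^ m\<close>.
\<close>

lemma derivs_bounded_difference:
  assumes "derivs_bounded (Suc m) K L g"
  shows "derivs_bounded m (K * L) L (\<lambda>x. g (x + 1) - g x)"
  using assms
proof (induction m arbitrary: K g)
  have bd: "\<bar>g (x + 1) - g x\<bar> \<le> K * L" if "derivs_bounded (Suc m) K L g" for m K g x
  proof -
    from that obtain g' where *:
      "\<And>x. (g has_real_derivative g' x) (at x)" "derivs_bounded m (K * L) L g'" by auto
    obtain z where "g (x + 1) - g x = (x + 1 - x) * g' z"
      using MVT2[of x "x + 1" g g'] *(1) by auto
    then show ?thesis using derivs_bounded_abs_le[OF *(2)] by simp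
  qed
  {
    case 0
    then show ?case using bd[OF 0] by simp
  next
    case (Suc m)
    from Suc.prems obtain g' where *:
      "\<And>x. (g has_real_derivative g' x) (at x)" "derivs_bounded (Suc m) (K * L) L g'" by auto
    have "((\<lambda>x. g (x + 1) - g x) has_real_derivative g' (x + 1) - g' x) (at x)" for x
      by (intro DERIV_diff *(1)) (use DERIV_shift[of g "g' (x + 1)" x 1] *(1) in simp)
    then show ?case using Suc.IH[OF *(2)] bd[OF Suc.prems]
      by (intro derivs_bounded_SucI[where g' = "\<lambda>x. g' (x + 1) - g' x"])
  }
qed

text \<open>
  Pascal's rule: the binomial sum is an iterated first difference.
\<close>

lemma diff_op_Suc:
  "diff_op (Suc M) h f x = diff_op M h (\<lambda>x. f (x + h) - f x) x"
proof -
  let ?c = "\<lambda>M j. (-1) ^ (M - j) * real (M choose j)"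
  have "diff_op (Suc M) h f x = (\<Sum>j\<le>Suc M. ?c (Suc M) j * f (x + real j *\<^sub>R h))"
    by (simp add: diff_op_def)
  also have "\<dots> = ?c (Suc M) 0 * f x + (\<Sum>j\<le>M. ?c (Suc M) (Suc j) * f (x + real (Suc j) *\<^sub>R h))"
    by (subst sum.atMost_Suc_shift) simp
  also have "(\<Sum>j\<le>M. ?c (Suc M) (Suc j) * f (x + real (Suc j) *\<^sub>R h))
      = (\<Sum>j\<le>M. ?c M j * f (x + real (Suc j) *\<^sub>R h))
        + (\<Sum>j\<le>M. (-1) ^ (M - j) * real (M choose Suc j) * f (x + real (Suc j) *\<^sub>R h))"
    by (simp add: sum.distrib[symmetric] algebra_simps)
  also have "(\<Sum>j\<le>M. (-1) ^ (M - j) * real (M choose Suc j) * f (x + real (Suc j) *\<^sub>R h))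
     = (\<Sum>j<M. (-1) ^ (M - j) * real (M choose Suc j) * f (x + real (Suc j) *\<^sub>R h))"
    by (rule sum.mono_neutral_right) (auto simp: not_less)
  also have "\<dots> = - (\<Sum>j<M. ?c M (Suc j) * f (x + real (Suc j) *\<^sub>R h))"
    unfolding sum_negf[symmetric]
  proof (rule sum.cong)
    fix j assume "j \<in> {..<M}"
    then have "M - j = Suc (M - Suc j)" by auto
    then show "(-1) ^ (M - j) * real (M choose Suc j) * f (x + real (Suc j) *\<^sub>R h)
       = - (?c M (Suc j) * f (x + real (Suc j) *\<^sub>R h))" by simp
  qed simp
  also have "?c (Suc M) 0 * f x = - (?c M 0 * f (x + real 0 *\<^sub>R h))" by simp
  finally have "diff_op (Suc M) h f x = (\<Sum>j\<le>M. ?c M j * f (x + real (Suc j) *\<^sub>R h))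
     - (?c M 0 * f (x + real 0 *\<^sub>R h) + (\<Sum>j<M. ?c M (Suc j) * f (x + real (Suc j) *\<^sub>R h)))"
    by simp
  also have "?c M 0 * f (x + real 0 *\<^sub>R h) + (\<Sum>j<M. ?c M (Suc j) * f (x + real (Suc j) *\<^sub>R h))
      = (\<Sum>j\<le>M. ?c M j * f (x + real j *\<^sub>R h))"
    by (rule sum.atMost_shift[symmetric])
  finally show ?thesis
    by (simp add: diff_op_def sum_subtractf[symmetric] algebra_simps)
qed

lemma diff_op_le_of_bounded:
  assumes "\<And>x. \<bar>f x\<bar> \<le> K"
  shows "\<bar>diff_op M h f x\<bar> \<le> 2 ^ M * K"
  using assms
proof (induction M arbitrary: f K)
  case 0
  then show ?case by (simp add: diff_op_def)
next
  case (Suc M)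
  have "\<bar>f (x + h) - f x\<bar> \<le> 2 * K" for x
    using Suc.prems[of x] Suc.prems[of "x + h"] by linarith
  from Suc.IH[OF this] show ?case by (simp add: diff_op_Suc mult_ac)
qed

lemma diff_op_le_of_derivs_bounded:
  assumes "derivs_bounded m K L g" "m \<le> M"
  shows "\<bar>diff_op M 1 g x\<bar> \<le> 2 ^ M * (K * L ^ m)"
  using assms
proof (induction m arbitrary: M K g)
  case 0
  then show ?case by (auto intro: diff_op_le_of_bounded)
next
  case (Suc m)
  obtain N where N: "M = Suc N" "m \<le> N" using Suc.prems(2) by (cases M) auto
  have "\<bar>diff_op M 1 g x\<bar> \<le> 2 ^ N * (K * L * L ^ m)"
    unfolding N diff_op_Suc by (rule Suc.IH[OF derivs_bounded_difference[OF Suc.prems(1)] N(2)])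
  also have "\<dots> \<le> 2 * (2 ^ N * (K * L * L ^ m))"
  proof -
    have "0 \<le> 2 ^ N * (K * L * L ^ m)" using calculation by linarith
    then show ?thesis by linarith
  qed
  finally show ?case by (simp add: N mult_ac)
qed

section \<open>Tiles of finite smoothness\<close>

text \<open>
  Restricted to \<open>[-1, 1]\<close> this is a polynomial, and it has \<open>n - 1\<close> continuous derivatives on the
  line. Every order of smoothness is reached by some \<open>n\<close>, which is enough: differences of higher
  order are bounded by those of the least order above \<open>s\<close>.
\<close>

definition bump :: "nat \<Rightarrow> real \<Rightarrow> real" where
  "bump n x = max 0 (1 - x\<^sup>2) ^ n"

lemma max_0_power_deriv:
  "((\<lambda>y::real. max 0 y ^ Suc (Suc n)) has_real_derivative real (Suc (Suc n)) * max 0 y ^ Suc n) (at y)"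
proof -
  consider "y > 0" | "y < 0" | "y = 0" by linarith
  then show ?thesis
  proof cases
    case 1
    have "((\<lambda>y::real. y ^ Suc (Suc n)) has_real_derivative real (Suc (Suc n)) * max 0 y ^ Suc n) (at y)"
      using 1 by (intro DERIV_cong[OF DERIV_pow]) (simp add: max_def)
    then show ?thesis
      by (rule has_field_derivative_transform_within_open[where S="{0<..}"]) (use 1 in auto)
  next
    case 2
    have "((\<lambda>y::real. 0) has_real_derivative real (Suc (Suc n)) * max 0 y ^ Suc n) (at y)"
      using 2 by (auto intro!: derivative_eq_intros)
    then show ?thesis
      by (rule has_field_derivative_transform_within_open[where S="{..<0}"]) (use 2 in auto)
  next
    case 3
    have "((\<lambda>x::real. (max 0 x ^ Suc (Suc n) - max 0 0 ^ Suc (Suc n)) / (x - 0)) \<longlongrightarrow> 0) (at 0)"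
    proof (rule Lim_null_comparison[where g="\<lambda>x. \<bar>x\<bar> ^ Suc n"])
      have "\<bar>max 0 x\<bar> ^ Suc (Suc n) \<le> \<bar>x\<bar> ^ Suc n * \<bar>x\<bar>" for x :: real
        using power_mono[of "\<bar>max 0 x\<bar>" "\<bar>x\<bar>" "Suc (Suc n)"] by (simp add: mult_ac)
      then show "\<forall>\<^sub>F x in at 0. norm ((max 0 x ^ Suc (Suc n) - max 0 0 ^ Suc (Suc n)) / (x - 0)) \<le> \<bar>x::real\<bar> ^ Suc n"
        by (intro always_eventually) (auto simp: divide_simps abs_mult power_abs)
      show "((\<lambda>x::real. \<bar>x\<bar> ^ Suc n) \<longlongrightarrow> 0) (at 0)"
        by (rule tendsto_eq_intros refl | simp)+
    qed
    then show ?thesis using 3 by (simp add: has_field_derivative_iff)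
  qed
qed

lemma bump_deriv:
  "(bump (Suc (Suc n)) has_real_derivative - 2 * real (Suc (Suc n)) * (x * bump (Suc n) x)) (at x)"
proof -
  have "((\<lambda>x::real. 1 - x\<^sup>2) has_real_derivative - 2 * x) (at x)"
    by (auto intro!: derivative_eq_intros)
  from DERIV_chain2[OF max_0_power_deriv this] show ?thesis
    unfolding bump_def by (rule DERIV_cong) (simp add: algebra_simps)
qed

lemma bump_bounds: "0 \<le> bump n x" "bump n x \<le> 1"
  by (auto simp: bump_def intro!: power_le_one)

lemma bump_eq_0: "\<bar>x\<bar> \<ge> 1 \<Longrightarrow> n > 0 \<Longrightarrow> bump n x = 0"
  using one_le_power[of "\<bar>x\<bar>" 2] by (auto simp: bump_def max_def)

lemma bump_ge: "\<bar>x\<bar> \<le> 1/2 \<Longrightarrow> (3/4) ^ n \<le> bump n x"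
  using power_mono[of "\<bar>x\<bar>" "1/2" 2] unfolding bump_def
  by (intro power_mono) (auto simp: power2_eq_square)

text \<open>
  The monomial factor makes the class closed under differentiation: the derivative of
  \<open>x ^ a * bump n x\<close> is a combination of two functions of the same form with \<open>n\<close> lowered by at
  most one. All of them are bounded by \<open>1\<close>, since \<open>bump\<close> vanishes outside \<open>[-1, 1]\<close>.
\<close>

lemma derivs_bounded_power_mult_bump:
  assumes "m < n"
  shows "\<exists>K. derivs_bounded m K 1 (\<lambda>x. x ^ a * bump n x)"
  using assms
proof (induction m arbitrary: n a)
  have bd: "\<bar>x ^ a * bump n x\<bar> \<le> 1" if "n > 0" for n a x
  proof (cases "\<bar>x\<bar> \<ge> 1")
    case False
    then show ?thesis using bump_bounds[of n x]
      by (auto simp: abs_mult power_abs intro!: mult_le_one power_le_one)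
  qed (use that in \<open>simp add: bump_eq_0\<close>)
  {
    case 0
    then show ?case using bd[where n=n and a=a] by (intro exI[of _ 1]) simp
  next
    case (Suc m)
    define k where "k = n - 2"
    have n: "n = Suc (Suc k)" using Suc.prems by (simp add: k_def)
    obtain K1 where K1: "derivs_bounded m K1 1 (\<lambda>x. x ^ (a - 1) * bump n x)"
      using Suc.IH[of n] Suc.prems by auto
    obtain K2 where K2: "derivs_bounded m K2 1 (\<lambda>x. x ^ (a + 1) * bump (Suc k) x)"
      using Suc.IH[of "Suc k" "a + 1"] Suc.prems n by blast
    let ?g = "\<lambda>x. real a * (x ^ (a - 1) * bump n x) + (- 2 * real n) * (x ^ (a + 1) * bump (Suc k) x)"
    let ?K = "\<bar>real a\<bar> * K1 + \<bar>- 2 * real n\<bar> * K2"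
    have g: "derivs_bounded m ?K 1 ?g"
      by (intro derivs_bounded_add derivs_bounded_cmult K1 K2)
    have "((\<lambda>x. x ^ a * bump n x) has_real_derivative ?g x) (at x)" for x
      by (rule DERIV_cong[OF DERIV_mult[OF DERIV_pow bump_deriv[of k, folded n]]]) (simp add: mult_ac)
    moreover have "derivs_bounded m (max ?K 1 * 1) 1 ?g"
      by (rule derivs_bounded_mono[OF g]) auto
    ultimately have "derivs_bounded (Suc m) (max ?K 1) 1 (\<lambda>x. x ^ a * bump n x)"
      using bd[where n=n and a=a] Suc.prems by (intro derivs_bounded_SucI[where g' = ?g]) (auto simp: le_max_iff_disj)
    then show ?case ..
  }
qed

lemma derivs_bounded_bump: "m < n \<Longrightarrow> \<exists>K\<ge>1. derivs_bounded m K 1 (bump n)"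
proof -
  assume "m < n"
  then obtain K where "derivs_bounded m K 1 (\<lambda>x. x ^ 0 * bump n x)"
    using derivs_bounded_power_mult_bump by blast
  then have "derivs_bounded m (max K 1) 1 (bump n)"
    by (auto intro: derivs_bounded_mono)
  then show ?thesis by (metis max.cobounded2)
qed

lemma bump_measurable [measurable]: "bump n \<in> borel_measurable borel"
  unfolding bump_def by measurable

definition box_bump :: "nat \<Rightarrow> real^'n \<Rightarrow> real \<Rightarrow> real^'n \<Rightarrow> real" where
  "box_bump n y r x = (\<Prod>i\<in>UNIV. bump n ((x $ i - y $ i) / r))"

lemma box_bump_bounds: "0 \<le> box_bump n y r x" "box_bump n y r x \<le> 1"
  unfolding box_bump_def by (rule prod_nonneg prod_le_1; simp add: bump_bounds)+

lemma box_bump_eq_0: "\<bar>x $ i - y $ i\<bar> \<ge> r \<Longrightarrow> n > 0 \<Longrightarrow> r > 0 \<Longrightarrow> box_bump n y r x = 0"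
  by (auto simp: box_bump_def intro!: bump_eq_0 exI[of _ i])

lemma box_bump_ge:
  fixes x :: "real^'n"
  assumes "\<And>i. \<bar>x $ i - y $ i\<bar> \<le> r / 2" "r > 0"
  shows "((3/4) ^ n) ^ CARD('n) \<le> box_bump n y r x"
proof -
  have "(\<Prod>i\<in>(UNIV::'n set). (3/4::real) ^ n) \<le> box_bump n y r x"
    unfolding box_bump_def using assms
    by (intro prod_mono conjI bump_ge) (auto simp: abs_divide pos_divide_le_eq)
  then show ?thesis by simp
qed

lemma box_bump_measurable [measurable]: "box_bump n y r \<in> borel_measurable borel"
  unfolding box_bump_def by measurable

lemma derivs_bounded_box_bump:
  fixes y :: "real^'n"
  assumes "derivs_bounded m K 1 (bump n)" "r > 0" "norm h / r \<le> L"
  shows "derivs_bounded m ((K * 2 ^ m) ^ CARD('n)) L (\<lambda>u. box_bump n y r (x + u *\<^sub>R h))"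
proof -
  have "0 \<le> norm h / r" using assms(2) by simp
  then have L: "0 \<le> L" using assms(3) by linarith
  have "derivs_bounded m K L (\<lambda>u. bump n (((x + u *\<^sub>R h) $ i - y $ i) / r))" for i
  proof -
    have "\<bar>h $ i / r\<bar> \<le> norm h / r"
      using assms(2) component_le_norm_cart[of h i] by (auto simp: divide_simps)
    then have "\<bar>h $ i / r\<bar> \<le> L" using assms(3) by linarith
    moreover have "derivs_bounded m K (1 * \<bar>h $ i / r\<bar>) (\<lambda>u. bump n ((x $ i - y $ i) / r + u * (h $ i / r)))"
      by (rule derivs_bounded_affine) (rule assms(1))
    ultimately have "derivs_bounded m K L (\<lambda>u. bump n ((x $ i - y $ i) / r + u * (h $ i / r)))"
      by (elim derivs_bounded_mono) auto
    moreover have "(x $ i - y $ i) / r + u * (h $ i / r) = ((x + u *\<^sub>R h) $ i - y $ i) / r" for u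
      using assms(2) by (simp add: field_simps)
    ultimately show ?thesis by simp
  qed
  then show ?thesis unfolding box_bump_def
    using derivs_bounded_prod[of "UNIV::'n set" m K L] L by simp
qed

section \<open>Growth of admissible functions\<close>

lemma dyadic_interval:
  assumes "0 < t" "t \<le> (1::real)"
  obtains j :: nat where "(1/2) ^ Suc j < t" "t \<le> (1/2) ^ j"
proof -
  obtain n where n: "(1/2::real) ^ n < t"
    using real_arch_pow_inv[OF assms(1), of "1/2"] by auto
  define m where "m = (LEAST n. (1/2::real) ^ n < t)"
  have m: "(1/2::real) ^ m < t" unfolding m_def using n by (rule LeastI)
  with assms obtain j where j: "m = Suc j" by (cases m) auto
  have "\<not> (1/2::real) ^ j < t" using j not_less_Least[of j "\<lambda>n. (1/2::real) ^ n < t"] by (simp add: m_def)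
  with m j that show ?thesis by auto
qed

lemma half_power_bounds: "0 < (1/2::real) ^ j" "(1/2::real) ^ j \<le> 1"
  by (auto intro: power_le_one)

lemma half_power_eq_powr: "(1/2::real) ^ n = 2 powr (- real n)"
  by (simp add: powr_minus_divide powr_realpow power_one_over)

text \<open>
  Doubling the index at the cost of a constant means polynomial growth, hence growth slower than
  any exponential \<open>\<rho> ^ i\<close>. Passing from \<open>j + i\<close> to \<open>j + i div 2\<close> loses one factor \<open>K\<close>, and half
  of the exponential pays for it once \<open>i\<close> is so large that \<open>K \<le> \<rho> ^ (i / 2)\<close>; the finitely many
  smaller \<open>i\<close> are absorbed into the constant.
\<close>

lemma doubling_growth:
  fixes u :: "nat \<Rightarrow> real"
  assumes pos: "\<And>j. 0 < u j" and mono: "mono u" and dbl: "\<And>j. u (2 * j) \<le> K * u j"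
    and "1 < \<rho>"
  obtains C where "1 \<le> C" "\<And>j i. u (j + i) \<le> C * u j * \<rho> ^ i"
proof -
  have "u 0 \<le> K * u 0" using dbl[of 0] by simp
  then have K: "1 \<le> K" using pos[of 0] by simp
  obtain N where "K < \<rho> ^ N" using real_arch_pow[OF assms(4)] by blast
  then have N: "K \<le> \<rho> ^ n" if "n \<ge> N" for n
    using power_increasing[OF that, of \<rho>] assms(4) by linarith
  have iter: "u (2 ^ i * j) \<le> K ^ i * u j" for i j
  proof (induction i)
    case (Suc i)
    have "u (2 ^ Suc i * j) \<le> K * u (2 ^ i * j)" using dbl[of "2 ^ i * j"] by (simp add: mult.assoc)
    also have "\<dots> \<le> K * (K ^ i * u j)" using Suc K by (intro mult_left_mono) auto
    finally show ?case by (simp add: mult.assoc)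
  qed simp
  define C where "C = K ^ (2 * N + 2)"
  have C: "1 \<le> C" unfolding C_def using K by (rule one_le_power)
  have growth: "u (j + i) \<le> C * u j * \<rho> ^ i" if "j \<ge> 1" for i j
    using that
  proof (induction i rule: less_induct)
    case (less i)
    show ?case
    proof (cases "i < 2 * N + 2")
      case True
      have "j + i \<le> 2 ^ i * j"
      proof -
        have "j + i \<le> j * (1 + i)" using less.prems by (simp add: algebra_simps)
        also have "\<dots> \<le> j * 2 ^ i" using Suc_leI[OF less_exp[of i]] by (intro mult_left_mono) auto
        finally show ?thesis by (simp add: mult.commute)
      qed
      then have "u (j + i) \<le> u (2 ^ i * j)" by (rule monoD[OF mono])
      also have "\<dots> \<le> K ^ i * u j" by (rule iter)
      also have "\<dots> \<le> C * u j" unfolding C_def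
        using True K pos[of j] by (intro mult_right_mono power_increasing) auto
      also have "\<dots> \<le> C * u j * \<rho> ^ i"
        using C pos[of j] assms(4) by (simp add: one_le_power)
      finally show ?thesis .
    next
      case False
      have "u (j + i) \<le> u (2 * (j + i div 2))"
        by (intro monoD[OF mono]) (use less.prems in presburger)
      also have "\<dots> \<le> K * u (j + i div 2)" by (rule dbl)
      also have "\<dots> \<le> \<rho> ^ (i - i div 2) * (C * u j * \<rho> ^ (i div 2))"
        using False less pos[of "j + i div 2"] K assms(4) by (intro mult_mono N less.IH) auto
      also have "\<dots> = C * u j * (\<rho> ^ (i - i div 2) * \<rho> ^ (i div 2))" by simp
      also have "\<rho> ^ (i - i div 2) * \<rho> ^ (i div 2) = \<rho> ^ i"
        by (simp flip: power_add)
      finally show ?thesis .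
    qed
  qed
  have u01: "1 \<le> u 1 / u 0" using monoD[OF mono, of 0 1] pos[of 0] by simp
  have "u (j + i) \<le> C * (u 1 / u 0) * u j * \<rho> ^ i" for j i
  proof (cases "j \<ge> 1")
    case True
    have "C * 1 * u j * \<rho> ^ i \<le> C * (u 1 / u 0) * u j * \<rho> ^ i"
      using C u01 pos[of j] assms(4) by (intro mult_right_mono mult_left_mono) auto
    then show ?thesis using growth[OF True, of i] by simp
  next
    case False
    then have j: "j = 0" by simp
    show ?thesis
    proof (cases i)
      case 0
      have "1 * u 0 \<le> C * (u 1 / u 0) * u 0"
        using C u01 pos[of 0] by (intro mult_right_mono) (use mult_mono[of 1 C 1 "u 1 / u 0"] in auto)
      then show ?thesis using 0 j by simp
    next
      case (Suc n)
      have "u (1 + n) \<le> C * u 1 * \<rho> ^ n" by (rule growth) simp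
      also have "\<dots> \<le> C * u 1 * \<rho> ^ i"
        using C pos[of 1] assms(4) Suc by (intro mult_left_mono power_increasing) auto
      also have "C * u 1 = C * (u 1 / u 0) * u 0" using pos[of 0] by simp
      finally show ?thesis using Suc j by simp
    qed
  qed
  moreover have "1 \<le> C * (u 1 / u 0)" using mult_mono[of 1 C 1 "u 1 / u 0"] C u01 by simp
  ultimately show ?thesis using that by blast
qed

lemma admissible_pos: "admissible \<Psi> \<Longrightarrow> 0 < t \<Longrightarrow> t \<le> 1 \<Longrightarrow> 0 < \<Psi> t"
  by (auto simp: admissible_def)

text \<open>
  The exponent \<open>j - k + (k - j)\<close>, with truncated subtraction, is the distance \<open>\<bar>j - k\<bar>\<close>.
  If \<open>\<Psi>\<close> decreases, the values \<open>\<Psi> ((1/2) ^ j)\<close> increase with \<open>j\<close> and double in index at bounded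
  cost; if \<open>\<Psi>\<close> increases, their reciprocals do.
\<close>

lemma admissible_growth:
  assumes "admissible \<Psi>" "1 < \<rho>"
  obtains C where "1 \<le> C"
    "\<And>j k. \<Psi> ((1/2) ^ j) \<le> C * \<Psi> ((1/2) ^ k) * \<rho> ^ (j - k + (k - j))"
proof -
  define \<psi> where "\<psi> j = \<Psi> ((1/2) ^ j)" for j :: nat
  have pos: "0 < \<psi> j" for j
    unfolding \<psi>_def by (rule admissible_pos[OF assms(1)]) (rule half_power_bounds)+
  obtain c D where cD: "0 < c" "c \<le> D" "\<And>j. c * \<psi> (2 * j) \<le> \<psi> j" "\<And>j. \<psi> j \<le> D * \<psi> (2 * j)"
    using assms(1) unfolding admissible_def \<psi>_def by blast
  have dec: "(1/2::real) ^ k \<le> (1/2) ^ j" if "j \<le> k" for j k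
    using that by (rule power_decreasing) auto
  have in01: "(1/2::real) ^ j \<in> {0<..1}" for j
    using half_power_bounds[of j] by simp
  have "\<exists>C\<ge>1. \<forall>j k. \<psi> j \<le> C * \<psi> k * \<rho> ^ (j - k + (k - j))"
  proof -
    consider "antimono_on {0<..1} \<Psi>" | "mono_on {0<..1} \<Psi>" using assms(1) by (auto simp: admissible_def)
    then show ?thesis
    proof cases
      case 1
      have m: "mono \<psi>"
        unfolding \<psi>_def by (intro monoI monotone_onD[OF 1] in01 dec)
      have "\<psi> (2 * j) \<le> (1/c) * \<psi> j" for j using cD(1) cD(3)[of j] by (simp add: field_simps)
      then obtain C where C: "1 \<le> C" "\<And>j i. \<psi> (j + i) \<le> C * \<psi> j * \<rho> ^ i"
        using doubling_growth[OF pos m _ assms(2)] by blast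
      have "\<psi> j \<le> C * \<psi> k * \<rho> ^ (j - k + (k - j))" for j k
      proof (cases "k \<le> j")
        case True
        then show ?thesis using C(2)[of k "j - k"] by simp
      next
        case False
        have "\<psi> j * (1 * 1) \<le> \<psi> k * (C * \<rho> ^ (k - j))"
          using False C(1) pos[of k] assms(2)
          by (intro mult_mono monoD[OF m] one_le_power) auto
        then show ?thesis using False by (simp add: mult_ac)
      qed
      with C show ?thesis by blast
    next
      case 2
      have a: "\<psi> k \<le> \<psi> j" if "j \<le> k" for j k
        unfolding \<psi>_def by (intro monotone_onD[OF 2] in01 dec that)
      have m: "mono (\<lambda>j. 1 / \<psi> j)"
        by (intro monoI divide_left_mono a mult_pos_pos pos) auto
      have "1 / \<psi> (2 * j) \<le> D * (1 / \<psi> j)" for j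
        using cD(4)[of j] pos[of j] pos[of "2 * j"] by (simp add: field_simps)
      then obtain C where C: "1 \<le> C" "\<And>j i. 1 / \<psi> (j + i) \<le> C * (1 / \<psi> j) * \<rho> ^ i"
        using doubling_growth[of "\<lambda>j. 1 / \<psi> j", OF _ m _ assms(2)] pos by auto
      have "\<psi> j \<le> C * \<psi> k * \<rho> ^ (j - k + (k - j))" for j k
      proof (cases "j \<le> k")
        case True
        then show ?thesis using C(2)[of j "k - j"] pos[of j] pos[of k] by (simp add: field_simps)
      next
        case False
        have "\<psi> j * (1 * 1) \<le> \<psi> k * (C * \<rho> ^ (j - k))"
          using False C(1) pos[of k] assms(2)
          by (intro mult_mono a one_le_power) auto
        then show ?thesis using False by (simp add: mult_ac)
      qed
      with C show ?thesis by blast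
    qed
  qed
  then show ?thesis using that unfolding \<psi>_def by blast
qed

lemma admissible_le_dyadic:
  assumes "admissible \<Psi>"
  obtains C where "1 \<le> C"
    "\<And>j t. (1/2) ^ Suc j < t \<Longrightarrow> t \<le> (1/2) ^ j \<Longrightarrow> \<Psi> t \<le> C * \<Psi> ((1/2) ^ j)"
proof -
  obtain C where C: "1 \<le> C"
    "\<And>j k. \<Psi> ((1/2) ^ j) \<le> C * \<Psi> ((1/2) ^ k) * 2 ^ (j - k + (k - j))"
    using admissible_growth[OF assms, of 2] by auto
  have "\<Psi> t \<le> (C * 2) * \<Psi> ((1/2) ^ j)" if t: "(1/2) ^ Suc j < t" "t \<le> (1/2) ^ j" for j t
  proof -
    have t01: "t \<in> {0<..1}"
      using order.strict_trans[OF half_power_bounds(1)[of "Suc j"] t(1)] order_trans[OF t(2) half_power_bounds(2)] by simp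
    have in01: "(1/2::real) ^ j \<in> {0<..1}" for j
      using half_power_bounds[of j] by simp
    consider "mono_on {0<..1} \<Psi>" | "antimono_on {0<..1} \<Psi>" using assms by (auto simp: admissible_def)
    then have "\<Psi> t \<le> \<Psi> ((1/2) ^ j) \<or> \<Psi> t \<le> \<Psi> ((1/2) ^ Suc j)"
    proof cases
      case 1
      then show ?thesis using monotone_onD[OF 1 t01 in01[of j] t(2)] by simp
    next
      case 2
      then show ?thesis using monotone_onD[OF 2 in01[of "Suc j"] t01 less_imp_le[OF t(1)]] by simp
    qed
    moreover have "\<Psi> ((1/2) ^ Suc j) \<le> C * 2 * \<Psi> ((1/2) ^ j)" using C(2)[of "Suc j" j] by simp
    moreover have "1 * \<Psi> ((1/2) ^ j) \<le> C * 2 * \<Psi> ((1/2) ^ j)"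
      using C(1) admissible_pos[OF assms half_power_bounds, of j] by (intro mult_right_mono) auto
    ultimately show ?thesis by linarith
  qed
  then show ?thesis using that[of "C * 2"] C(1) by auto
qed

section \<open>Geometric tails\<close>

lemma two_sided_geometric:
  assumes "0 \<le> \<theta>" "\<theta> < (1::real)"
  shows "(\<Sum>j. ennreal (\<theta> ^ (j - k + (k - j)))) \<le> ennreal (2 / (1 - \<theta>))"
proof -
  have geo: "(\<lambda>n. \<theta> ^ n) sums (1 / (1 - \<theta>))" using assms by (intro geometric_sums) auto
  let ?f = "\<lambda>j. \<theta> ^ (j - k + (k - j))"
  have "(\<lambda>n. ?f (n + k)) sums (1 / (1 - \<theta>))" using geo by simp
  then have "?f sums (1 / (1 - \<theta>) + (\<Sum>j<k. ?f j))" by (subst (asm) sums_iff_shift) (simp add: add.commute)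
  moreover have "(\<Sum>j<k. ?f j) \<le> 1 / (1 - \<theta>)"
  proof -
    have "(\<Sum>j<k. ?f j) = (\<Sum>j<k. \<theta> ^ Suc j)"
      by (rule sum.reindex_bij_witness[of _ "\<lambda>j. k - Suc j" "\<lambda>j. k - Suc j"]) (auto simp: Suc_diff_Suc)
    also have "\<dots> \<le> (\<Sum>j<k. \<theta> ^ j)" using assms by (intro sum_mono power_decreasing) auto
    also have "\<dots> \<le> 1 / (1 - \<theta>)"
      using sum_le_suminf[OF sums_summable[OF geo], of "{..<k}"] assms sums_unique[OF geo] by simp
    finally show ?thesis .
  qed
  moreover have "(\<Sum>j. ennreal (?f j)) = ennreal (1 / (1 - \<theta>) + (\<Sum>j<k. ?f j))"
    using calculation(1) assms by (intro suminf_ennreal_eq) auto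
  ultimately show ?thesis by (auto intro!: ennreal_leI simp: add_divide_distrib[symmetric])
qed

lemma term_le_suminf:
  fixes f :: "nat \<Rightarrow> ennreal"
  shows "f i \<le> (\<Sum>i. f i)"
  using sum_le_suminf[of f "{i}"] by simp

lemma suminf_ennreal_swap:
  fixes F :: "nat \<Rightarrow> nat \<Rightarrow> ennreal"
  shows "(\<Sum>j. \<Sum>k. F j k) = (\<Sum>k. \<Sum>j. F j k)"
  using nn_integral_suminf[of "\<lambda>k j. F j k" "count_space UNIV"]
  by (simp add: nn_integral_count_space_nat)

text \<open>
  The envelope is the convolution of \<open>\<beta>\<close> with the two-sided geometric sequence. It replaces a
  discrete Young inequality: instead of bounding a sum \<open>\<Sum>k. b k * \<theta> ^ \<bar>j - k\<bar>\<close> in \<open>\<ell>\<^sup>q\<close>, each term is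
  bounded by a power of \<open>T j\<close> and half of the geometric decay remains to sum over \<open>k\<close>.
\<close>

lemma two_sided_envelope:
  assumes "\<And>k. 0 \<le> \<beta> k" "summable \<beta>" "0 \<le> \<theta>" "\<theta> < (1::real)"
  obtains T where "\<And>j. 0 \<le> T j" "summable T" "\<And>j k. \<beta> k * \<theta> ^ (j - k + (k - j)) \<le> T j"
proof -
  define F where "F j k = ennreal (\<beta> k * \<theta> ^ (j - k + (k - j)))" for j k :: nat
  have "(\<Sum>j. \<Sum>k. F j k) = (\<Sum>k. ennreal (\<beta> k) * (\<Sum>j. ennreal (\<theta> ^ (j - k + (k - j)))))"
    unfolding F_def using assms by (subst suminf_ennreal_swap) (simp add: ennreal_mult flip: ennreal_suminf_cmult)
  also have "\<dots> \<le> (\<Sum>k. ennreal (\<beta> k) * ennreal (2 / (1 - \<theta>)))"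
    using assms by (intro suminf_le mult_left_mono two_sided_geometric) auto
  also have "\<dots> = (\<Sum>k. ennreal (\<beta> k)) * ennreal (2 / (1 - \<theta>))" by simp
  also have "\<dots> < \<infinity>"
    using ennreal_suminf_neq_top[OF assms(2,1)] by (simp add: ennreal_mult_less_top less_top)
  finally have fin: "(\<Sum>j. \<Sum>k. F j k) < \<infinity>" .
  define T where "T j = enn2real (\<Sum>k. F j k)" for j
  have T: "(\<Sum>k. F j k) = ennreal (T j)" for j
    unfolding T_def using ennreal_suminf_lessD[OF fin, of j] by (simp add: less_top)
  have "summable T"
    using fin unfolding T by (intro summable_suminf_not_top) (auto simp: T_def less_top)
  moreover have "\<beta> k * \<theta> ^ (j - k + (k - j)) \<le> T j" for j k
  proof -
    have "F j k \<le> ennreal (T j)" unfolding T[symmetric] by (rule term_le_suminf)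
    then show ?thesis by (simp add: F_def T_def ennreal_le_iff)
  qed
  ultimately show ?thesis using that[of T] by (simp add: T_def)
qed

section \<open>A recurrent covering by cubes of summable weight\<close>

text \<open>
  At \<open>\<eta> = 1\<close> the expression is \<open>2 powr (m * (1 - q / p)) < 1\<close>; a slightly larger \<open>\<eta>\<close> keeps it
  below \<open>1\<close>. This is the place where \<open>p < q\<close> matters.
\<close>

lemma covering_ratio:
  fixes p q :: real and m :: nat
  assumes "0 < p" "p < q" "0 < m"
  obtains \<eta> where "1 < \<eta>" "(2 * \<eta>) ^ m * (\<eta> powr p * (1/2) ^ m) powr (q / p) < 1"
proof -
  have m: "real m > 0" using assms by simp
  define X where "X = m * (q / p - 1)"
  have X: "0 < X" unfolding X_def using assms m by (intro mult_pos_pos) auto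
  have mq: "0 < m + q" using m assms by linarith
  define \<delta> where "\<delta> = X / 2 / (m + q)"
  have \<delta>: "0 < \<delta>" unfolding \<delta>_def using X mq by simp
  have "\<delta> * (m + q) = X / 2" unfolding \<delta>_def using mq by (intro nonzero_eq_divide_eq[THEN iffD1]) auto
  then have "\<delta> * m + \<delta> * q < X" using X by (simp only: distrib_left)
  moreover have "X = m * q / p - m" unfolding X_def by (simp add: right_diff_distrib)
  ultimately have expo: "(1 + \<delta>) * m + \<delta> * q - m * q / p < 0" unfolding distrib_right by linarith
  define \<eta> where "\<eta> = 2 powr \<delta>"
  have \<eta>: "1 < \<eta>" unfolding \<eta>_def using \<delta> by simp
  have "(2 * \<eta>) ^ m * (\<eta> powr p * (1/2) ^ m) powr (q / p) = 2 powr ((1 + \<delta>) * m + \<delta> * q - m * q / p)"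
  proof -
    have "(2 * \<eta>) ^ m = (2 powr (1 + \<delta>)) ^ m"
      unfolding \<eta>_def by (simp add: powr_add)
    also have "\<dots> = 2 powr ((1 + \<delta>) * m)" by (simp add: powr_power mult.commute)
    finally have "(2 * \<eta>) ^ m = 2 powr ((1 + \<delta>) * m)" .
    moreover have "(1/2::real) ^ m = 2 powr (- real m)"
      by (simp add: powr_minus_divide powr_realpow power_one_over)
    moreover have "(2 powr (\<delta> * p - m)) powr (q / p) = 2 powr (\<delta> * q - m * q / p)"
    proof -
      have "(\<delta> * p - m) * (q / p) = \<delta> * q - m * q / p"
        unfolding left_diff_distrib using assms by simp
      then show ?thesis by (simp only: powr_powr)
    qed
    moreover have "\<eta> powr p * 2 powr (- real m) = 2 powr (\<delta> * p - m)"
      unfolding \<eta>_def by (simp add: powr_powr flip: powr_add)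
    ultimately show ?thesis by (simp only: powr_add[symmetric] add_diff_eq)
  qed
  moreover have "2 powr ((1 + \<delta>) * m + \<delta> * q - m * q / p) < 1"
    using expo by (intro powr_less_one) auto
  ultimately show ?thesis using that[OF \<eta>] by simp
qed

text \<open>
  For each \<open>l\<close>, cubes of side \<open>(1/2) ^ l\<close> cover the cube of half-side about \<open>\<eta> ^ l\<close>; about
  \<open>(2 * \<eta>) ^ (l * m)\<close> of them are needed, where \<open>m\<close> is the dimension. Each receives its own index \<open>k\<close>
  and the height \<open>\<eta> ^ l\<close>. The total volume at stage \<open>l\<close> grows, so every point is covered at every
  late stage, under unbounded heights; yet the \<open>q / p\<close>-th powers of the weights
  \<open>height ^ p * volume\<close> are summable, with ratio \<open>\<theta>\<close> from stage to stage. The encoding of pairs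
  \<open>(l, n)\<close> by \<open>k\<close> satisfies \<open>l \<le> k\<close>, which yields \<open>(1/2) ^ k \<le> r k\<close>.
\<close>

lemma recurrent_covering:
  fixes p q :: real
  assumes "0 < p" "p < q"
  obtains a r :: "nat \<Rightarrow> real" and z :: "nat \<Rightarrow> real^'e" where
    "\<And>k. 0 \<le> a k" "\<And>k. (1/2) ^ k \<le> r k"
    "summable (\<lambda>k. (a k powr p * r k ^ CARD('e)) powr (q / p))"
    "\<And>x A n. \<exists>k\<ge>n. A \<le> a k \<and> (\<forall>i. \<bar>x $ i - z k $ i\<bar> \<le> r k / 2)"
proof -
  define m where "m = CARD('e)"
  obtain \<eta> where \<eta>: "1 < \<eta>" and "(2 * \<eta>) ^ m * (\<eta> powr p * (1/2) ^ m) powr (q / p) < 1"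
    using covering_ratio[OF assms, of m] by (auto simp: m_def)
  moreover define \<theta> where "\<theta> = (2 * \<eta>) ^ m * (\<eta> powr p * (1/2) ^ m) powr (q / p)"
  ultimately have \<theta>: "0 < \<theta>" "\<theta> < 1" by auto
  define B where "B l = \<lfloor>(2 * \<eta>) ^ l\<rfloor>" for l :: nat
  define Q where "Q l = (PiE UNIV (\<lambda>_. {- B l..B l}) :: ('e \<Rightarrow> int) set)" for l
  have B: "1 \<le> B l" for l unfolding B_def using one_le_power[of "2 * \<eta>" l] \<eta> by (simp only: one_le_floor)
  have finQ: "finite (Q l)" for l unfolding Q_def by (intro finite_PiE) auto
  have cardQ: "real (card (Q l)) \<le> 3 ^ m * ((2 * \<eta>) ^ m) ^ l" for l
  proof -
    have "card (Q l) = (\<Prod>i\<in>(UNIV::'e set). nat (2 * B l + 1))"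
      unfolding Q_def by (subst card_PiE) (auto simp: algebra_simps)
    then have "real (card (Q l)) = real_of_int (2 * B l + 1) ^ m" using B[of l] by (simp add: m_def)
    also have "\<dots> \<le> (3 * (2 * \<eta>) ^ l) ^ m"
    proof (intro power_mono)
      have "real_of_int (B l) \<le> (2 * \<eta>) ^ l" unfolding B_def by linarith
      moreover have "1 \<le> (2 * \<eta>) ^ l" using \<eta> by (intro one_le_power) auto
      ultimately show "real_of_int (2 * B l + 1) \<le> 3 * (2 * \<eta>) ^ l" by simp
    qed (use B[of l] in auto)
    also have "\<dots> = 3 ^ m * ((2 * \<eta>) ^ m) ^ l"
      by (simp add: power_mult_distrib power_mult[symmetric] mult.commute)
    finally show ?thesis .
  qed
  \<comment> \<open>Indices that do not encode a cube receive height \<open>0\<close>.\<close>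
  define a where "a k = (case prod_decode k of (l, n) \<Rightarrow> if n \<in> to_nat ` Q l then \<eta> ^ l else 0)" for k
  define r where "r k = (case prod_decode k of (l, n) \<Rightarrow> (1/2::real) ^ l)" for k
  define z where "z k = (case prod_decode k of (l, n) \<Rightarrow>
      (\<chi> i. (1/2) ^ l * real_of_int ((from_nat n :: 'e \<Rightarrow> int) i)))" for k
  have "0 \<le> a k" for k using \<eta> by (auto simp: a_def split: prod.splits)
  moreover have "(1/2) ^ k \<le> r k" for k
  proof -
    obtain l n where ln: "prod_decode k = (l, n)" by force
    then have "l \<le> k" using le_prod_encode_1[of l n] by (metis prod_decode_inverse)
    then show ?thesis unfolding r_def ln by (auto intro: power_decreasing)
  qed
  moreover have "summable (\<lambda>k. (a k powr p * r k ^ m) powr (q / p))"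
  proof (rule summable_suminf_not_top)
    define g where "g l n = (if n \<in> to_nat ` Q l then ((\<eta> powr p * (1/2) ^ m) powr (q / p)) ^ l else 0)" for l n
    have "(a k powr p * r k ^ m) powr (q / p) = (case prod_decode k of (l, n) \<Rightarrow> g l n)" for k
    proof -
      obtain l n where ln: "prod_decode k = (l, n)" by force
      have "((\<eta> ^ l) powr p * ((1/2) ^ l) ^ m) powr (q / p) = ((\<eta> powr p * (1/2) ^ m) powr (q / p)) ^ l"
      proof -
        have "(\<eta> ^ l) powr p = (\<eta> powr p) ^ l"
          using \<eta> by (simp add: powr_powr mult.commute flip: powr_realpow)
        moreover have "((1/2::real) ^ l) ^ m = ((1/2) ^ m) ^ l" by (simp add: power_mult[symmetric] mult.commute)
        moreover have "(x ^ l) powr y = (x powr y) ^ l" if "x > 0" for x y :: real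
          using that by (simp add: powr_powr mult.commute flip: powr_realpow)
        ultimately show ?thesis using \<eta> by (simp flip: power_mult_distrib)
      qed
      then show ?thesis by (simp add: ln a_def r_def g_def)
    qed
    then have "(\<Sum>k. ennreal ((a k powr p * r k ^ m) powr (q / p)))
        = (\<Sum>k. (\<lambda>(l, n). ennreal (g l n)) (prod_decode k))"
      by (simp add: case_prod_unfold)
    also have "\<dots> = (\<Sum>l. \<Sum>n. ennreal (g l n))"
      by (rule suminf_ennreal_2dimen) simp
    also have "\<dots> \<le> (\<Sum>l. ennreal (3 ^ m * \<theta> ^ l))"
    proof (intro suminf_le allI)
      fix l
      have "(\<Sum>n. ennreal (g l n)) = (\<Sum>n\<in>to_nat ` Q l. ennreal (g l n))"
        using finQ by (intro suminf_finite) (auto simp: g_def)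
      also have "\<dots> = ennreal (real (card (to_nat ` Q l)) * ((\<eta> powr p * (1/2) ^ m) powr (q / p)) ^ l)"
        by (simp add: g_def ennreal_mult ennreal_of_nat_eq_real_of_nat)
      also have "card (to_nat ` Q l) = card (Q l)" by (rule card_image) (rule inj_on_subset[OF inj_to_nat subset_UNIV])
      also have "real (card (Q l)) * ((\<eta> powr p * (1/2) ^ m) powr (q / p)) ^ l
          \<le> (3 ^ m * ((2 * \<eta>) ^ m) ^ l) * ((\<eta> powr p * (1/2) ^ m) powr (q / p)) ^ l"
        by (intro mult_right_mono cardQ) auto
      also have "\<dots> = 3 ^ m * \<theta> ^ l" by (simp add: \<theta>_def power_mult_distrib)
      finally show "(\<Sum>n. ennreal (g l n)) \<le> ennreal (3 ^ m * \<theta> ^ l)" by (simp add: ennreal_leI)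
    qed auto
    also have "\<dots> < top"
      using \<theta> by (subst less_top[symmetric], intro ennreal_suminf_neq_top summable_mult summable_geometric) auto
    finally show "(\<Sum>k. ennreal ((a k powr p * r k ^ m) powr (q / p))) \<noteq> top" by simp
  qed auto
  moreover have "\<exists>k\<ge>n. A \<le> a k \<and> (\<forall>i. \<bar>x $ i - z k $ i\<bar> \<le> r k / 2)" for x A n
  proof -
    obtain l0 where l0: "max A (norm x + 1) < \<eta> ^ l0" using real_arch_pow[OF \<eta>] by blast
    define l where "l = max l0 n"
    have "\<eta> ^ l0 \<le> \<eta> ^ l" unfolding l_def using \<eta> by (intro power_increasing) auto
    with l0 have l: "A \<le> \<eta> ^ l" "norm x + 1 \<le> \<eta> ^ l" by auto
    \<comment> \<open>The lattice point nearest to \<open>x\<close> at stage \<open>l\<close>.\<close>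
    define v where "v i = round (2 ^ l * x $ i)" for i
    have v: "\<bar>real_of_int (v i) - 2 ^ l * x $ i\<bar> \<le> 1/2" for i
      unfolding v_def by (rule of_int_round_abs_le)
    have "v i \<in> {- B l..B l}" for i
    proof -
      have "\<bar>2 ^ l * x $ i\<bar> = 2 ^ l * \<bar>x $ i\<bar>" by (simp add: abs_mult)
      moreover have "2 ^ l * \<bar>x $ i\<bar> \<le> 2 ^ l * norm x"
        by (intro mult_left_mono component_le_norm_cart) auto
      moreover have "(1::real) \<le> 2 ^ l" by (rule one_le_power) simp
      ultimately have "\<bar>real_of_int (v i)\<bar> \<le> 2 ^ l * (norm x + 1)"
        using v[of i] unfolding distrib_left by linarith
      also have "\<dots> \<le> (2 * \<eta>) ^ l" using l(2) by (simp add: power_mult_distrib)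
      finally have "\<bar>v i\<bar> \<le> B l" unfolding B_def by (simp add: le_floor_iff)
      then show ?thesis by auto
    qed
    then have vQ: "v \<in> Q l" unfolding Q_def by (intro PiE_I) auto
    define k where "k = prod_encode (l, to_nat v)"
    have dec: "prod_decode k = (l, to_nat v)" by (simp add: k_def)
    have "n \<le> k" using le_prod_encode_1[of l "to_nat v"] by (simp add: k_def l_def)
    moreover have "a k = \<eta> ^ l" using vQ by (simp add: a_def dec)
    moreover have "\<bar>x $ i - z k $ i\<bar> \<le> r k / 2" for i
    proof -
      have "(1/2::real) ^ l * 2 ^ l = 1" by (simp flip: power_mult_distrib)
      then have "x $ i - z k $ i = - ((1/2) ^ l * (real_of_int (v i) - 2 ^ l * x $ i))"
        by (simp add: z_def dec right_diff_distrib mult.assoc[symmetric] del: power_one_over)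
      also have "\<bar>\<dots>\<bar> \<le> (1/2) ^ l * (1/2)"
        unfolding abs_minus abs_mult using v[of i] by (intro mult_mono) auto
      finally show ?thesis by (simp add: r_def dec)
    qed
    ultimately show ?thesis using l(1) by auto
  qed
  ultimately show ?thesis using that[of a r z] unfolding m_def by blast
qed

section \<open>Differences of sums with disjoint supports\<close>

text \<open>
  A substitute for both Minkowski's inequality and the quasi-triangle inequality that is uniform
  in the exponent, at the price of a factor depending on the number of terms.
\<close>

lemma sum_powr_le:
  fixes A :: "'k \<Rightarrow> real"
  assumes "finite K" "\<And>k. k \<in> K \<Longrightarrow> 0 \<le> A k" "0 \<le> P"
  shows "(\<Sum>k\<in>K. A k) powr P \<le> real (card K) powr P * (\<Sum>k\<in>K. A k powr P)"
proof (cases "K = {}")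
  case False
  then have "Max (A ` K) \<in> A ` K" using assms(1) by (intro Max_in) auto
  then obtain k where k: "k \<in> K" "A k = Max (A ` K)" by (metis imageE)
  have "(\<Sum>k\<in>K. A k) \<le> real (card K) * A k"
    using assms(1) by (intro sum_bounded_above) (auto simp: k(2))
  then have "(\<Sum>k\<in>K. A k) powr P \<le> (real (card K) * A k) powr P"
    using assms by (intro powr_mono2 sum_nonneg) auto
  also have "\<dots> = real (card K) powr P * A k powr P"
    using assms(2)[OF k(1)] by (simp add: powr_mult)
  also have "A k powr P \<le> (\<Sum>k\<in>K. A k powr P)"
    using k(1) assms(1) by (intro member_le_sum) auto
  finally show ?thesis by (simp add: mult_left_mono)
qed simp

lemma emeasure_lebesgue_shift_cbox:
  fixes l :: "'a::euclidean_space"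
  shows "{x. x + v \<in> cbox l u} \<in> sets lebesgue"
    "emeasure lebesgue {x. x + v \<in> cbox l u} = ennreal (measure lborel (cbox l u))"
proof -
  have eq: "{x. x + v \<in> cbox l u} = cbox (l - v) (u - v)"
    by (auto simp: mem_box inner_diff_left inner_add_left algebra_simps)
  show "{x. x + v \<in> cbox l u} \<in> sets lebesgue" unfolding eq by simp
  have "emeasure lborel (cbox (l - v) (u - v)) = emeasure lborel (cbox l u)"
    by (simp add: emeasure_lborel_cbox_eq inner_diff_left)
  moreover have "emeasure lborel (cbox l u) = ennreal (measure lborel (cbox l u))"
    by (rule emeasure_eq_ennreal_measure) (use emeasure_lborel_cbox_finite[of l u] in auto)
  ultimately show "emeasure lebesgue {x. x + v \<in> cbox l u} = ennreal (measure lborel (cbox l u))"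
    unfolding eq by simp
qed

text \<open>
  The difference at \<open>x\<close> samples the function at \<open>M + 1\<close> nodes, and each node lies in at most one of
  the boxes. So at most \<open>M + 1\<close> summands contribute at \<open>x\<close>, and the \<open>p\<close>-th power of their sum is
  comparable to the sum of the \<open>p\<close>-th powers, for every \<open>P\<close> and with no constant depending on the
  number of boxes. Moreover \<open>k\<close> contributes only when a node lies in its box, which confines \<open>x\<close> to
  \<open>M + 1\<close> translates of that box.
\<close>

lemma nn_integral_diff_op_disjoint_sum:
  fixes F :: "nat \<Rightarrow> 'a::euclidean_space \<Rightarrow> real"
  assumes supp: "\<And>k x. F k x \<noteq> 0 \<Longrightarrow> x \<in> cbox (l k) (u k)"
    and disj: "\<And>k k' x. x \<in> cbox (l k) (u k) \<Longrightarrow> x \<in> cbox (l k') (u k') \<Longrightarrow> k = k'"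
    and bound: "\<And>k x. \<bar>diff_op M h (F k) x\<bar> \<le> A k"
    and "0 \<le> P"
  shows "(\<integral>\<^sup>+x. ennreal (\<bar>diff_op M h (\<lambda>x. \<Sum>k. F k x) x\<bar> powr P) \<partial>lebesgue)
    \<le> (\<Sum>k. ennreal ((real M + 1) powr P * (real M + 1) * (A k powr P * measure lborel (cbox (l k) (u k)))))"
proof -
  define S where "S k = cbox (l k) (u k)" for k
  define E where "E k j = {x. x + real j *\<^sub>R h \<in> S k}" for k j
  define c where "c k = (real M + 1) powr P * A k powr P" for k
  have A: "0 \<le> A k" for k using bound[of k 0] by linarith
  have c: "0 \<le> c k" for k by (simp add: c_def)
  have pt: "ennreal (\<bar>diff_op M h (\<lambda>x. \<Sum>k. F k x) x\<bar> powr P)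
      \<le> (\<Sum>k. ennreal (c k) * (\<Sum>j\<le>M. indicator (E k j) x))" for x
  proof -
    \<comment> \<open>The summands that are seen from \<open>x\<close>.\<close>
    define K where "K = {k. \<exists>j\<le>M. x + real j *\<^sub>R h \<in> S k}"
    have sub: "K \<subseteq> (\<lambda>j. SOME k. x + real j *\<^sub>R h \<in> S k) ` {..M}"
    proof
      fix k assume "k \<in> K"
      then obtain j where j: "j \<le> M" "x + real j *\<^sub>R h \<in> S k" by (auto simp: K_def)
      have "(SOME k. x + real j *\<^sub>R h \<in> S k) = k"
        using j(2) disj unfolding S_def by (intro some_equality) auto
      then show "k \<in> (\<lambda>j. SOME k. x + real j *\<^sub>R h \<in> S k) ` {..M}" using j(1) by force
    qed
    have finK: "finite K" using sub by (rule finite_subset) auto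
    have "card K \<le> card {..M}" using sub by (rule surj_card_le[rotated]) auto
    then have cardK: "real (card K) \<le> real M + 1" by simp
    have "(\<Sum>k. F k (x + real j *\<^sub>R h)) = (\<Sum>k\<in>K. F k (x + real j *\<^sub>R h))" if "j \<le> M" for j
      using that finK supp by (intro suminf_finite) (auto simp: K_def S_def)
    then have "diff_op M h (\<lambda>x. \<Sum>k. F k x) x = (\<Sum>k\<in>K. diff_op M h (F k) x)"
      unfolding diff_op_def by (subst sum.swap) (simp add: sum_distrib_left)
    also have "\<bar>\<dots>\<bar> \<le> (\<Sum>k\<in>K. A k)"
      by (rule order_trans[OF sum_abs]) (intro sum_mono bound)
    finally have "\<bar>diff_op M h (\<lambda>x. \<Sum>k. F k x) x\<bar> powr P \<le> (\<Sum>k\<in>K. A k) powr P"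
      using assms(4) by (intro powr_mono2) auto
    also have "\<dots> \<le> real (card K) powr P * (\<Sum>k\<in>K. A k powr P)"
      using finK A assms(4) by (intro sum_powr_le) auto
    also have "\<dots> \<le> (real M + 1) powr P * (\<Sum>k\<in>K. A k powr P)"
      using cardK assms(4) by (intro mult_right_mono powr_mono2 sum_nonneg) auto
    also have "\<dots> = (\<Sum>k\<in>K. c k)" by (simp add: c_def sum_distrib_left)
    finally have "ennreal (\<bar>diff_op M h (\<lambda>x. \<Sum>k. F k x) x\<bar> powr P) \<le> (\<Sum>k\<in>K. ennreal (c k))"
      using c by (subst sum_ennreal) (auto intro: ennreal_leI)
    also have "\<dots> \<le> (\<Sum>k\<in>K. ennreal (c k) * (\<Sum>j\<le>M. indicator (E k j) x))"
    proof (rule sum_mono)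
      fix k assume "k \<in> K"
      then obtain j where j: "j \<le> M" "x \<in> E k j" by (auto simp: K_def E_def)
      have "(1::ennreal) = indicator (E k j) x" using j by simp
      also have "\<dots> \<le> (\<Sum>j\<le>M. indicator (E k j) x)" using j by (intro member_le_sum) auto
      finally show "ennreal (c k) \<le> ennreal (c k) * (\<Sum>j\<le>M. indicator (E k j) x)"
        using mult_left_mono[of 1 _ "ennreal (c k)"] by simp
    qed
    also have "\<dots> \<le> (\<Sum>k. ennreal (c k) * (\<Sum>j\<le>M. indicator (E k j) x))"
      using finK by (intro sum_le_suminf) auto
    finally show ?thesis .
  qed
  have E: "E k j \<in> sets lebesgue" "emeasure lebesgue (E k j) = ennreal (measure lborel (S k))" for k j
    unfolding E_def S_def by (rule emeasure_lebesgue_shift_cbox)+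
  have "(\<integral>\<^sup>+x. ennreal (\<bar>diff_op M h (\<lambda>x. \<Sum>k. F k x) x\<bar> powr P) \<partial>lebesgue)
      \<le> (\<integral>\<^sup>+x. (\<Sum>k. ennreal (c k) * (\<Sum>j\<le>M. indicator (E k j) x)) \<partial>lebesgue)"
    by (intro nn_integral_mono pt)
  also have "\<dots> = (\<Sum>k. \<integral>\<^sup>+x. ennreal (c k) * (\<Sum>j\<le>M. indicator (E k j) x) \<partial>lebesgue)"
    using E by (intro nn_integral_suminf) auto
  also have "\<dots> = (\<Sum>k. ennreal (c k) * (\<Sum>j\<le>M. emeasure lebesgue (E k j)))"
    using E(1) by (simp add: nn_integral_cmult nn_integral_sum)
  also have "\<dots> = (\<Sum>k. ennreal ((real M + 1) powr P * (real M + 1) * (A k powr P * measure lborel (S k))))"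
  proof (rule suminf_cong)
    fix k
    have "(\<Sum>j\<le>M. emeasure lebesgue (E k j)) = ennreal ((real M + 1) * measure lborel (S k))"
      by (simp add: E(2) ennreal_mult ennreal_of_nat_eq_real_of_nat ennreal_plus add.commute)
    then show "ennreal (c k) * (\<Sum>j\<le>M. emeasure lebesgue (E k j))
        = ennreal ((real M + 1) powr P * (real M + 1) * (A k powr P * measure lborel (S k)))"
      by (simp add: c_def ennreal_mult[symmetric] mult_ac)
  qed
  finally show ?thesis by (simp add: S_def)
qed

section \<open>Dyadic bounds for the Besov seminorm\<close>

lemma ennpow_ennreal: "0 \<le> x \<Longrightarrow> ennpow (ennreal x) r = ennreal (x powr r)"
  by (simp add: ennpow_def)

lemma ennpow_mono:
  assumes "x \<le> y" "0 \<le> r"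
  shows "ennpow x r \<le> ennpow y r"
proof (cases "y = \<infinity>")
  case False
  then have "x \<noteq> \<infinity>" using assms(1) by (auto simp: top_unique)
  moreover have "enn2real x \<le> enn2real y" using False assms(1) by (intro enn2real_mono) (auto simp: less_top)
  ultimately show ?thesis using False assms(2) by (auto simp: ennpow_def intro!: ennreal_leI powr_mono2)
qed (simp add: ennpow_def)

lemma Lp_norm_le:
  assumes "0 < P" "0 \<le> G" "(\<integral>\<^sup>+x. ennreal (\<bar>g x\<bar> powr P) \<partial>lebesgue) \<le> ennreal (G powr P)"
  shows "Lp_norm (ennreal P) g \<le> ennreal G"
proof -
  have "Lp_norm (ennreal P) g = ennpow (\<integral>\<^sup>+x. ennreal (\<bar>g x\<bar> powr P) \<partial>lebesgue) (1 / P)"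
    using assms(1) by (simp add: Lp_norm_def)
  also have "\<dots> \<le> ennpow (ennreal (G powr P)) (1 / P)"
    using assms by (intro ennpow_mono) auto
  also have "\<dots> = ennreal G" using assms by (simp add: ennpow_ennreal powr_powr)
  finally show ?thesis .
qed

lemma Lp_norm_ge:
  assumes "0 < P" "0 \<le> G" "ennreal (G powr P) \<le> (\<integral>\<^sup>+x. ennreal (\<bar>g x\<bar> powr P) \<partial>lebesgue)"
  shows "ennreal G \<le> Lp_norm (ennreal P) g"
proof -
  have "ennreal G = ennpow (ennreal (G powr P)) (1 / P)"
    using assms by (simp add: ennpow_ennreal powr_powr)
  also have "\<dots> \<le> ennpow (\<integral>\<^sup>+x. ennreal (\<bar>g x\<bar> powr P) \<partial>lebesgue) (1 / P)"
    using assms by (intro ennpow_mono) auto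
  also have "\<dots> = Lp_norm (ennreal P) g"
    using assms(1) by (simp add: Lp_norm_def)
  finally show ?thesis .
qed

text \<open>
  On \<open>{(1/2) ^ Suc j<..(1/2) ^ j}\<close> the weight \<open>\<Psi> t / t powr s\<close> is within a constant factor of its
  value at the right end point, so the integral becomes a sum over \<open>j\<close>.
\<close>

lemma besov_seminorm_finite:
  fixes f :: "'a::euclidean_space \<Rightarrow> real" and s :: real
  assumes adm: "admissible \<Psi>" and "0 \<le> s" "0 < q"
    and G0: "\<And>j. 0 \<le> G j"
    and G: "\<And>j h. norm h \<le> (1/2) ^ j \<Longrightarrow> Lp_norm p (diff_op M h f) \<le> ennreal (G j)"
    and bounded: "\<And>j. 2 powr (s * j) * \<Psi> ((1/2) ^ j) * G j \<le> D"
    and summable: "q \<noteq> \<infinity> \<Longrightarrow> summable (\<lambda>j. (2 powr (s * j) * \<Psi> ((1/2) ^ j) * G j) powr enn2real q)"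
  shows "besov_seminorm M p q s \<Psi> f < \<infinity>"
proof -
  obtain C where C: "1 \<le> C"
    "\<And>j t. (1/2) ^ Suc j < t \<Longrightarrow> t \<le> (1/2) ^ j \<Longrightarrow> \<Psi> t \<le> C * \<Psi> ((1/2) ^ j)"
    using admissible_le_dyadic[OF adm] by blast
  define w where "w j = 2 powr (s * j) * \<Psi> ((1/2) ^ j) * G j" for j :: nat
  have \<psi>: "0 < \<Psi> ((1/2) ^ j)" for j :: nat
    by (rule admissible_pos[OF adm half_power_bounds])
  have w0: "0 \<le> w j" for j using G0[of j] \<psi>[of j] by (simp add: w_def)
  have tpow: "t powr (- a) \<le> 2 powr (a * (real j + 1))" if "(1/2) ^ Suc j < t" "0 \<le> a" for t a :: real and j :: nat
  proof -
    have "t powr (- a) \<le> ((1/2) ^ Suc j) powr (- a)"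
      using that by (intro powr_mono2') auto
    also have "\<dots> = 2 powr (a * (real j + 1))" unfolding half_power_eq_powr powr_powr by (simp add: algebra_simps)
    finally show ?thesis .
  qed
  have t0: "0 < t" if "(1/2) ^ Suc j < t" for t :: real and j :: nat
    using order.strict_trans[OF half_power_bounds(1) that] .
  have \<Psi>t: "0 < \<Psi> t" if "(1/2) ^ Suc j < t" "t \<le> (1/2) ^ j" for t :: real and j :: nat
    using admissible_pos[OF adm t0[OF that(1)] order_trans[OF that(2) half_power_bounds(2)]] .
  show ?thesis
  proof (cases "q = \<infinity>")
    case True
    have "ennreal (t powr (- s) * \<Psi> t) * (SUP h\<in>cball 0 t. Lp_norm p (diff_op M h f))
        \<le> ennreal (2 powr s * C * D)" if t: "t \<in> {0<..1}" for t
    proof -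
      obtain j where j: "(1/2) ^ Suc j < t" "t \<le> (1/2) ^ j" using dyadic_interval t by auto
      have "(SUP h\<in>cball 0 t. Lp_norm p (diff_op M h f)) \<le> ennreal (G j)"
        using j(2) by (intro SUP_least G) auto
      moreover have "t powr (- s) * \<Psi> t \<le> 2 powr (s * (real j + 1)) * (C * \<Psi> ((1/2) ^ j))"
        using less_imp_le[OF \<Psi>t[OF j]] assms(2) by (intro mult_mono tpow[OF j(1)] C(2)[OF j]) auto
      ultimately have "ennreal (t powr (- s) * \<Psi> t) * (SUP h\<in>cball 0 t. Lp_norm p (diff_op M h f))
          \<le> ennreal (2 powr (s * (real j + 1)) * (C * \<Psi> ((1/2) ^ j))) * ennreal (G j)"
        by (intro mult_mono[OF ennreal_leI]) auto
      also have "\<dots> = ennreal (2 powr s * C * w j)"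
        using G0[of j] \<psi>[of j] C(1) unfolding w_def
        by (simp add: ennreal_mult[symmetric] distrib_left powr_add mult_ac)
      also have "\<dots> \<le> ennreal (2 powr s * C * D)"
        using bounded[of j] C(1) unfolding w_def by (intro ennreal_leI mult_left_mono) auto
      finally show ?thesis .
    qed
    then have "besov_seminorm M p q s \<Psi> f \<le> ennreal (2 powr s * C * D)"
      using True unfolding besov_seminorm_def by (auto intro!: SUP_least)
    then show ?thesis by (rule order.strict_trans1) simp
  next
    case False
    define R where "R = enn2real q"
    have R: "0 < R" unfolding R_def using False assms(3) by (simp add: enn2real_positive_iff less_top)
    define I where "I j = {(1/2::real) ^ Suc j<..(1/2) ^ j}" for j :: nat
    define H where "H j = G j powr R * ((C * \<Psi> ((1/2) ^ j)) powr R * 2 powr ((1 + s * R) * (real j + 1)))" for j :: nat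
    have H0: "0 \<le> H j" for j by (simp add: H_def)
    define J where "J t = (SUP h\<in>cball 0 t. ennpow (Lp_norm p (diff_op M h f)) R)
        * ennreal (\<Psi> t powr R / t powr (1 + s * R))" for t
    have pt: "J t * indicator {0<..1} t \<le> (\<Sum>j. ennreal (H j) * indicator (I j) t)" for t
    proof (cases "t \<in> {0<..1}")
      case True
      then obtain j where j: "(1/2) ^ Suc j < t" "t \<le> (1/2) ^ j" using dyadic_interval by auto
      have "(SUP h\<in>cball 0 t. ennpow (Lp_norm p (diff_op M h f)) R) \<le> ennreal (G j powr R)"
      proof (rule SUP_least)
        fix h :: 'a assume "h \<in> cball 0 t"
        then have "Lp_norm p (diff_op M h f) \<le> ennreal (G j)" using j(2) by (intro G) auto
        then show "ennpow (Lp_norm p (diff_op M h f)) R \<le> ennreal (G j powr R)"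
          using ennpow_mono[of _ "ennreal (G j)" R] R by (simp add: ennpow_ennreal G0)
      qed
      moreover have "\<Psi> t powr R / t powr (1 + s * R)
          \<le> (C * \<Psi> ((1/2) ^ j)) powr R * 2 powr ((1 + s * R) * (real j + 1))"
        unfolding divide_inverse powr_minus[symmetric]
        using R assms(2) less_imp_le[OF \<Psi>t[OF j]] C(2)[OF j]
        by (intro mult_mono powr_mono2 tpow[OF j(1)]) auto
      ultimately have "J t \<le> ennreal (G j powr R) * ennreal ((C * \<Psi> ((1/2) ^ j)) powr R * 2 powr ((1 + s * R) * (real j + 1)))"
        unfolding J_def by (intro mult_mono[OF _ ennreal_leI]) auto
      also have "\<dots> = ennreal (H j) * indicator (I j) t"
        using j by (simp add: H_def I_def ennreal_mult)
      also have "\<dots> \<le> (\<Sum>j. ennreal (H j) * indicator (I j) t)"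
        by (rule term_le_suminf)
      finally show ?thesis using True by simp
    qed simp
    have I: "I j \<in> sets lebesgue" for j by (simp add: I_def)
    have "(\<integral>\<^sup>+t. J t * indicator {0<..1} t \<partial>lebesgue)
        \<le> (\<integral>\<^sup>+t. (\<Sum>j. ennreal (H j) * indicator (I j) t) \<partial>lebesgue)"
      by (intro nn_integral_mono pt)
    also have "\<dots> = (\<Sum>j. \<integral>\<^sup>+t. ennreal (H j) * indicator (I j) t \<partial>lebesgue)"
      using I by (intro nn_integral_suminf) simp
    also have "\<dots> = (\<Sum>j. ennreal ((2 powr s * C) powr R * w j powr R))"
    proof (rule suminf_cong)
      fix j
      have "emeasure lebesgue (I j) = ennreal ((1/2) ^ Suc j)"
        by (simp add: I_def emeasure_lborel_Ioc)
      then have "(\<integral>\<^sup>+t. ennreal (H j) * indicator (I j) t \<partial>lebesgue) = ennreal (H j * (1/2) ^ Suc j)"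
        using H0[of j] I[of j] by (simp only: nn_integral_cmult_indicator) (simp add: ennreal_mult[symmetric])
      also have "H j * (1/2) ^ Suc j = (2 powr s * C) powr R * w j powr R"
      proof -
        have "2 powr ((1 + s * R) * (real j + 1)) * (1/2) ^ Suc j = 2 powr (s * R * (real j + 1))"
          unfolding half_power_eq_powr powr_add[symmetric] by (simp add: algebra_simps)
        also have "\<dots> = (2 powr s) powr R * (2 powr (s * j)) powr R"
          unfolding powr_powr powr_add[symmetric] by (simp add: algebra_simps)
        finally show ?thesis unfolding H_def w_def
          using C(1) \<psi>[of j] G0[of j] by (simp add: powr_mult mult_ac)
      qed
      finally show "(\<integral>\<^sup>+t. ennreal (H j) * indicator (I j) t \<partial>lebesgue) = ennreal ((2 powr s * C) powr R * w j powr R)" .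
    qed
    also have "\<dots> < top"
      using summable[OF False] unfolding w_def R_def
      by (subst less_top[symmetric], intro ennreal_suminf_neq_top summable_mult) auto
    finally have "(\<integral>\<^sup>+t. J t * indicator {0<..1} t \<partial>lebesgue) \<noteq> \<infinity>" by simp
    then show ?thesis
      using False unfolding besov_seminorm_def J_def R_def by (simp add: ennpow_def)
  qed
qed

section \<open>Summation over scales\<close>

text \<open>
  \<open>B k\<close> is the \<open>P\<close>-th power of the weight of a tile of scale \<open>(1/2) ^ k\<close>, normalised by
  \<open>2 powr (- s * k) / \<Psi> ((1/2) ^ k)\<close>, and the power of \<open>1/2\<close> is the gain of a difference with step
  \<open>(1/2) ^ j\<close>: none for \<open>j \<le> k\<close>, as the subtraction is truncated, and \<open>m\<close> orders for larger \<open>j\<close>.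
  Compared with the normalisation at \<open>j\<close>, finer tiles are damped by \<open>s > 0\<close>, coarser ones by
  \<open>m > s\<close>, and \<open>\<Psi>\<close> is absorbed by an arbitrarily small part of either. This leaves decay
  \<open>\<rho> powr (- \<bar>j - k\<bar>)\<close>; half of it goes into the envelope \<open>T\<close>, half into the sum over \<open>k\<close>.
\<close>

lemma weighted_sum_bound:
  fixes s P Q :: real and B :: "nat \<Rightarrow> real"
  assumes adm: "admissible \<Psi>" and s: "0 < s" "s < real m" and PQ: "0 < P" "P < Q"
    and B: "\<And>k. 0 \<le> B k" "summable (\<lambda>k. B k powr (Q / P))"
  obtains T E where "\<And>j. 0 \<le> T j" "summable T" "0 \<le> E"
    "\<And>j. (\<Sum>k. ennreal (B k * (2 powr (- s * k) / \<Psi> ((1/2) ^ k) * (1/2) ^ ((j - k) * m)) powr P))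
        \<le> ennreal ((E * (2 powr (- s * j) / \<Psi> ((1/2) ^ j)) * T j powr (1 / Q)) powr P)"
proof -
  \<comment> \<open>Either damping has rate at least \<open>2 * \<epsilon>\<close>, and \<open>\<Psi>\<close> costs \<open>\<epsilon>\<close>.\<close>
  define \<epsilon> where "\<epsilon> = min s (real m - s) / 2"
  have \<epsilon>: "0 < \<epsilon>" "2 * \<epsilon> \<le> s" "2 * \<epsilon> \<le> real m - s" using s by (auto simp: \<epsilon>_def)
  define \<rho> where "\<rho> = 2 powr \<epsilon>"
  have \<rho>: "1 < \<rho>" using \<epsilon> by (simp add: \<rho>_def)
  define v where "v k = 2 powr (- s * k) / \<Psi> ((1/2) ^ k)" for k :: nat
  have \<psi>: "0 < \<Psi> ((1/2) ^ k)" for k :: nat by (rule admissible_pos[OF adm half_power_bounds])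
  have v: "0 < v k" for k using \<psi>[of k] by (simp add: v_def)
  define N where "N j k = j - k + (k - j)" for j k :: nat
  obtain C where C: "1 \<le> C" "\<And>j k. \<Psi> ((1/2) ^ j) \<le> C * \<Psi> ((1/2) ^ k) * \<rho> ^ N j k"
    unfolding N_def using admissible_growth[OF adm \<rho>] by metis
  have decay: "v k * (1/2) ^ ((j - k) * m) \<le> v j * (C * \<rho> powr (- real (N j k)))" for j k
  proof -
    have 1: "2 powr (- s * k) * (1/2) ^ ((j - k) * m) \<le> 2 powr (- s * j) * \<rho> powr (- 2 * real (N j k))"
    proof (cases "j \<le> k")
      case True
      have "2 * \<epsilon> * (real k - real j) \<le> s * (real k - real j)" using True \<epsilon> by (intro mult_right_mono) auto
      then have "- s * real k \<le> - s * real j + \<epsilon> * (- 2 * real (N j k))"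
        using True by (simp add: N_def of_nat_diff algebra_simps)
      then show ?thesis unfolding \<rho>_def powr_powr powr_add[symmetric] using True by simp
    next
      case False
      have "2 * \<epsilon> * (real j - real k) \<le> (real m - s) * (real j - real k)" using False \<epsilon> by (intro mult_right_mono) auto
      then have "- s * real k + - real ((j - k) * m) \<le> - s * real j + \<epsilon> * (- 2 * real (N j k))"
        using False by (simp add: N_def of_nat_diff algebra_simps)
      then show ?thesis unfolding \<rho>_def half_power_eq_powr powr_powr powr_add[symmetric] by simp
    qed
    have 2: "1 / \<Psi> ((1/2) ^ k) \<le> C * \<rho> powr (real (N j k)) / \<Psi> ((1/2) ^ j)"
      using C(2)[of j k] \<psi>[of j] \<psi>[of k] \<rho> by (simp add: field_simps powr_realpow)
    have "2 powr (- s * k) * (1/2) ^ ((j - k) * m) * (1 / \<Psi> ((1/2) ^ k))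
        \<le> 2 powr (- s * j) * \<rho> powr (- 2 * real (N j k)) * (C * \<rho> powr (real (N j k)) / \<Psi> ((1/2) ^ j))"
      using less_imp_le[OF \<psi>[of k]] by (intro mult_mono[OF 1 2]) auto
    also have "\<dots> = v j * (C * (\<rho> powr (- 2 * real (N j k)) * \<rho> powr (real (N j k))))"
      by (simp add: v_def)
    also have "\<rho> powr (- 2 * real (N j k)) * \<rho> powr (real (N j k)) = \<rho> powr (- real (N j k))"
      unfolding powr_add[symmetric] by simp
    finally show ?thesis by (simp add: v_def)
  qed
  \<comment> \<open>\<open>Q / 2\<close> here and \<open>P / 2\<close> in \<open>Bk\<close> both stand for half of the decay rate of one tile.\<close>
  define \<theta> where "\<theta> = \<rho> powr (- Q / 2)"
  have \<theta>: "0 \<le> \<theta>" "\<theta> < 1" using \<rho> PQ by (auto simp: \<theta>_def powr_less_one)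
  obtain T where T: "\<And>j. 0 \<le> T j" "summable T" "\<And>j k. B k powr (Q / P) * \<theta> ^ N j k \<le> T j"
    unfolding N_def using two_sided_envelope[of "\<lambda>k. B k powr (Q / P)" \<theta>] B(2) \<theta> by (metis powr_ge_zero)
  have Bk: "B k \<le> T j powr (P / Q) * \<rho> powr (P / 2 * real (N j k))" for j k
  proof -
    have "B k powr (Q / P) * \<rho> powr (- Q / 2 * real (N j k)) \<le> T j"
      using T(3)[of k j] \<rho> unfolding \<theta>_def by (simp add: powr_realpow[symmetric] powr_powr)
    then have "(B k powr (Q / P) * \<rho> powr (- Q / 2 * real (N j k))) powr (P / Q) \<le> T j powr (P / Q)"
      using PQ by (intro powr_mono2) auto
    also have "(B k powr (Q / P) * \<rho> powr (- Q / 2 * real (N j k))) powr (P / Q) = B k * \<rho> powr (- (P / 2 * real (N j k)))"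
      using PQ B(1)[of k] by (simp add: powr_mult powr_powr mult.commute)
    finally show ?thesis using \<rho> by (simp add: powr_minus field_simps)
  qed
  define \<theta>' where "\<theta>' = \<rho> powr (- P / 2)"
  have \<theta>': "0 \<le> \<theta>'" "\<theta>' < 1" using \<rho> PQ by (auto simp: \<theta>'_def powr_less_one)
  define E where "E = C * (2 / (1 - \<theta>')) powr (1 / P)"
  have "0 \<le> E" using C(1) by (simp add: E_def)
  moreover have "(\<Sum>k. ennreal (B k * (v k * (1/2) ^ ((j - k) * m)) powr P))
        \<le> ennreal ((E * v j * T j powr (1 / Q)) powr P)" for j
  proof -
    define W where "W = (C * v j * T j powr (1 / Q)) powr P"
    have "B k * (v k * (1/2) ^ ((j - k) * m)) powr P \<le> W * \<theta>' ^ N k j" for k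
    proof -
      have "B k * (v k * (1/2) ^ ((j - k) * m)) powr P
          \<le> (T j powr (P / Q) * \<rho> powr (P / 2 * real (N j k))) * (v j * (C * \<rho> powr (- real (N j k)))) powr P"
        using PQ v[of k] by (intro mult_mono Bk powr_mono2 decay) auto
      also have "\<dots> = W * (\<rho> powr (P / 2 * real (N j k)) * \<rho> powr (- (P * real (N j k))))"
        using PQ C(1) v[of j] T(1)[of j] by (simp add: W_def powr_mult powr_powr mult_ac)
      also have "\<rho> powr (P / 2 * real (N j k)) * \<rho> powr (- (P * real (N j k))) = \<theta>' ^ N j k"
        using \<rho> unfolding \<theta>'_def powr_add[symmetric] by (simp add: powr_realpow[symmetric] powr_powr)
      also have "N j k = N k j" by (simp add: N_def)
      finally show ?thesis .
    qed
    then have "(\<Sum>k. ennreal (B k * (v k * (1/2) ^ ((j - k) * m)) powr P)) \<le> (\<Sum>k. ennreal (W * \<theta>' ^ N k j))"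
      by (intro suminf_le ennreal_leI) auto
    also have "\<dots> = ennreal W * (\<Sum>k. ennreal (\<theta>' ^ N k j))"
      using \<theta>' by (simp add: W_def ennreal_mult)
    also have "\<dots> \<le> ennreal W * ennreal (2 / (1 - \<theta>'))"
      unfolding N_def by (intro mult_left_mono two_sided_geometric \<theta>') auto
    also have "\<dots> = ennreal ((E * v j * T j powr (1 / Q)) powr P)"
      using PQ C(1) v[of j] T(1)[of j] \<theta>' by (simp add: ennreal_mult[symmetric] W_def E_def powr_mult powr_powr mult_ac)
    finally show ?thesis .
  qed
  ultimately show ?thesis using that[of T E] T(1,2) unfolding v_def by blast
qed

section \<open>Sums of tiles at separated places\<close>

definition tile :: "nat \<Rightarrow> real^'d \<Rightarrow> real \<Rightarrow> real^'e \<Rightarrow> real \<Rightarrow> (real^'d) \<times> (real^'e) \<Rightarrow> real" where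
  "tile n y \<tau> z r = (\<lambda>(x', x''). box_bump n y \<tau> x' * box_bump n z r x'')"

lemma tile_bounds: "0 \<le> tile n y \<tau> z r x" "tile n y \<tau> z r x \<le> 1"
  by (auto simp: tile_def case_prod_unfold box_bump_bounds mult_le_one)

text \<open>
  The half-side \<open>r\<close> may be much larger than \<open>(1/2) ^ k\<close>: relative to the finer side a step of length
  \<open>(1/2) ^ j\<close> has size \<open>2 * (1/2) ^ (j - k)\<close>, and relative to the coarser one it is smaller. The
  constant \<open>D\<close> is independent of the shape and place of the tile.
\<close>

lemma diff_op_tile_bound:
  assumes "m < n" "m \<le> M"
  obtains D where "0 \<le> D"
    "\<And>j k h x (y::real^'d) (z::real^'e) r. norm h \<le> (1/2) ^ j \<Longrightarrow> (1/2) ^ k \<le> r \<Longrightarrow>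
       \<bar>diff_op M h (tile n y ((1/2) ^ Suc k) z r) x\<bar> \<le> D * (1/2) ^ ((j - k) * m)"
proof -
  obtain K where K: "1 \<le> K" "derivs_bounded m K 1 (bump n)"
    using derivs_bounded_bump[OF assms(1)] by blast
  define B where "B = (K * 2 ^ m) ^ CARD('d) * (K * 2 ^ m) ^ CARD('e) * 2 ^ m"
  have K': "1 \<le> K * 2 ^ m" using mult_mono[of 1 K 1 "2 ^ m"] K(1) by (simp add: one_le_power)
  have "1 * 1 * 1 \<le> B" unfolding B_def using K(1) by (intro mult_mono one_le_power K') auto
  then have B: "1 \<le> B" by simp
  define D where "D = 2 ^ M * (B * 2 ^ m)"
  have "\<bar>diff_op M h (tile n y ((1/2) ^ Suc k) z r) x\<bar> \<le> D * (1/2) ^ ((j - k) * m)"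
    if h: "norm h \<le> (1/2) ^ j" and r: "(1/2) ^ k \<le> r" for j k h x r and y :: "real^'d" and z :: "real^'e"
  proof (cases "j \<le> k")
    case True
    have "1 * 1 \<le> B * 2 ^ m" using B by (intro mult_mono one_le_power) auto
    then have "2 ^ M * 1 \<le> D" unfolding D_def by (intro mult_left_mono) auto
    moreover have "\<bar>diff_op M h (tile n y ((1/2) ^ Suc k) z r) x\<bar> \<le> 2 ^ M * 1"
      using tile_bounds[of n y "(1/2) ^ Suc k" z r] by (intro diff_op_le_of_bounded) (auto simp: abs_le_iff intro: order_trans)
    ultimately show ?thesis using True by simp
  next
    case False
    define \<tau> where "\<tau> = (1/2::real) ^ Suc k"
    define L where "L = norm h / \<tau>"
    have \<tau>: "0 < \<tau>" using half_power_bounds[of k] by (simp add: \<tau>_def)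
    have "\<tau> = (1/2) ^ k / 2" by (simp add: \<tau>_def)
    then have r\<tau>: "\<tau> \<le> r" using r half_power_bounds[of k] by linarith
    have L0: "0 \<le> L" using \<tau> by (simp add: L_def)
    have h12: "norm (fst h) / \<tau> \<le> L" "norm (snd h) / r \<le> L"
      unfolding L_def using \<tau> r\<tau> norm_fst_le[of "fst h" "snd h"] norm_snd_le[of "snd h" "fst h"]
      by (auto intro!: frac_le divide_right_mono)
    have "L \<le> (1/2) ^ j / \<tau>" unfolding L_def using h \<tau> by (intro divide_right_mono) auto
    also have "\<dots> = 2 * (1/2) ^ (j - k)"
      using False by (simp add: \<tau>_def power_diff)
    finally have L: "L \<le> 2 * (1/2) ^ (j - k)" .
    have "derivs_bounded m B L (\<lambda>u. box_bump n y \<tau> (fst x + u *\<^sub>R fst h) * box_bump n z r (snd x + u *\<^sub>R snd h))"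
      unfolding B_def using \<tau> r\<tau> by (intro derivs_bounded_mult derivs_bounded_box_bump K h12) auto
    then have "\<bar>diff_op M 1 (\<lambda>u. box_bump n y \<tau> (fst x + u *\<^sub>R fst h) * box_bump n z r (snd x + u *\<^sub>R snd h)) 0\<bar> \<le> 2 ^ M * (B * L ^ m)"
      by (rule diff_op_le_of_derivs_bounded) (rule assms(2))
    also have "diff_op M 1 (\<lambda>u. box_bump n y \<tau> (fst x + u *\<^sub>R fst h) * box_bump n z r (snd x + u *\<^sub>R snd h)) 0
        = diff_op M h (tile n y \<tau> z r) x"
      by (simp add: diff_op_def tile_def case_prod_unfold)
    also have "2 ^ M * (B * L ^ m) \<le> 2 ^ M * (B * (2 * (1/2) ^ (j - k)) ^ m)"
      using B L0 L by (intro mult_left_mono power_mono) auto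
    also have "\<dots> = D * (1/2) ^ ((j - k) * m)"
      by (simp add: D_def power_mult_distrib power_mult)
    finally show ?thesis by (simp add: \<tau>_def)
  qed
  moreover have "0 \<le> D" using B by (simp add: D_def)
  ultimately show ?thesis using that by blast
qed

lemma tile_measurable [measurable]:
  fixes y :: "real^'d" and z :: "real^'e"
  shows "tile n y \<tau> z r \<in> borel_measurable borel"
proof -
  have fst: "fst \<in> borel_measurable (borel :: ((real^'d) \<times> (real^'e)) measure)"
    and snd: "snd \<in> borel_measurable (borel :: ((real^'d) \<times> (real^'e)) measure)"
    by (intro borel_measurable_continuous_onI continuous_intros)+
  show ?thesis unfolding tile_def case_prod_unfold
    by (intro borel_measurable_times measurable_compose[OF fst] measurable_compose[OF snd] box_bump_measurable)
qed

lemma mem_cube: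
  fixes x y :: "real^'d"
  shows "x \<in> cbox (y - (\<chi> i. \<tau>)) (y + (\<chi> i. \<tau>)) \<longleftrightarrow> (\<forall>i. \<bar>x $ i - y $ i\<bar> \<le> \<tau>)"
  by (auto simp: mem_box_cart abs_le_iff algebra_simps)

lemma tile_support:
  fixes y :: "real^'d" and z :: "real^'e"
  assumes "tile n y \<tau> z r x \<noteq> 0" "0 < n" "0 < \<tau>" "0 < r"
  shows "x \<in> cbox (y - (\<chi> i. \<tau>), z - (\<chi> i. r)) (y + (\<chi> i. \<tau>), z + (\<chi> i. r))"
proof -
  have "\<bar>fst x $ i - y $ i\<bar> < \<tau>" for i
    using assms box_bump_eq_0[of \<tau> "fst x" i y n] by (fastforce simp: tile_def case_prod_unfold)
  moreover have "\<bar>snd x $ i - z $ i\<bar> < r" for i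
    using assms box_bump_eq_0[of r "snd x" i z n] by (fastforce simp: tile_def case_prod_unfold)
  ultimately show ?thesis
    unfolding cbox_Pair_eq mem_Times_iff mem_cube by (auto intro: less_imp_le)
qed

lemma measure_cube:
  fixes y :: "real^'d"
  assumes "0 \<le> \<tau>"
  shows "measure lborel (cbox (y - (\<chi> i. \<tau>)) (y + (\<chi> i. \<tau>))) = (2 * \<tau>) ^ CARD('d)"
  using assms by (subst content_cbox_cart) (auto simp: interval_ne_empty_cart)

lemma measure_tile_support:
  fixes y :: "real^'d" and z :: "real^'e"
  assumes "0 \<le> \<tau>" "0 \<le> r"
  shows "measure lborel (cbox (y - (\<chi> i. \<tau>), z - (\<chi> i. r)) (y + (\<chi> i. \<tau>), z + (\<chi> i. r)))
    = (2 * \<tau>) ^ CARD('d) * (2 * r) ^ CARD('e)"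
  unfolding content_Pair using assms by (simp add: measure_cube)

lemma besov_seminorm_infinity_ge:
  assumes "0 < t" "t \<le> 1" "norm h \<le> t" "ennreal A \<le> Lp_norm p (diff_op M h f)"
  shows "ennreal (t powr (- s) * \<Psi> t) * ennreal A \<le> besov_seminorm M p \<infinity> s \<Psi> f"
proof -
  have "ennreal A \<le> (SUP h\<in>cball 0 t. Lp_norm p (diff_op M h f))"
    by (rule SUP_upper2[of h]) (use assms in auto)
  then have "ennreal (t powr (- s) * \<Psi> t) * ennreal A
      \<le> ennreal (t powr (- s) * \<Psi> t) * (SUP h\<in>cball 0 t. Lp_norm p (diff_op M h f))"
    by (rule mult_left_mono) simp
  also have "\<dots> \<le> besov_seminorm M p \<infinity> s \<Psi> f"
    unfolding besov_seminorm_def using assms by (auto intro!: SUP_upper2[of t])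
  finally show ?thesis .
qed

text \<open>
  The \<open>x'\<close>-supports are cubes of half-side at most \<open>1/2\<close> with centres at distance at least \<open>4\<close> in
  each coordinate. So the boxes carrying the tiles are disjoint whatever \<open>z\<close> and \<open>r\<close> are, and a step
  walk of length at most \<open>1\<close> does not lead from one to another.
\<close>

definition tile_sum :: "nat \<Rightarrow> (nat \<Rightarrow> real) \<Rightarrow> (nat \<Rightarrow> real^'e) \<Rightarrow> (nat \<Rightarrow> real)
    \<Rightarrow> (real^'d) \<times> (real^'e) \<Rightarrow> real" where
  "tile_sum n c z r x = (\<Sum>k. c k * tile n (\<chi> i. 4 * real k) ((1/2) ^ Suc k) (z k) (r k) x)"

lemma tile_sum_measurable: "tile_sum n c z r \<in> borel_measurable borel"
  unfolding tile_sum_def by measurable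

lemma nn_integral_diff_op_tile_sum:
  assumes "m < n" "m \<le> M" "0 < P"
  obtains W where "0 \<le> W"
    "\<And>c r (z :: nat \<Rightarrow> real^'e) j (h :: (real^'d) \<times> (real^'e)).
       (\<And>k. 0 \<le> c k) \<Longrightarrow> (\<And>k. (1/2) ^ k \<le> r k) \<Longrightarrow> norm h \<le> (1/2) ^ j \<Longrightarrow>
       (\<integral>\<^sup>+x. ennreal (\<bar>diff_op M h (tile_sum n c z r) x\<bar> powr P) \<partial>lebesgue)
       \<le> (\<Sum>k. ennreal (W * (c k powr P * ((1/2) ^ k) ^ CARD('d) * r k ^ CARD('e)
              * ((1/2) ^ ((j - k) * m)) powr P)))"
proof -
  obtain D where D: "0 \<le> D"
    "\<And>j k h x (y::real^'d) (z::real^'e) r. norm h \<le> (1/2) ^ j \<Longrightarrow> (1/2) ^ k \<le> r \<Longrightarrow>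
       \<bar>diff_op M h (tile n y ((1/2) ^ Suc k) z r) x\<bar> \<le> D * (1/2) ^ ((j - k) * m)"
    using diff_op_tile_bound[OF assms(1,2), where 'd = 'd and 'e = 'e] by metis
  define W where "W = (real M + 1) powr P * (real M + 1) * (D powr P * 2 ^ CARD('e))"
  have "(\<integral>\<^sup>+x. ennreal (\<bar>diff_op M h (tile_sum n c z r) x\<bar> powr P) \<partial>lebesgue)
      \<le> (\<Sum>k. ennreal (W * (c k powr P * ((1/2) ^ k) ^ CARD('d) * r k ^ CARD('e)
              * ((1/2) ^ ((j - k) * m)) powr P)))"
    if c: "\<And>k. 0 \<le> c k" and r: "\<And>k. (1/2) ^ k \<le> r k" and h: "norm h \<le> (1/2) ^ j"
    for c r and z :: "nat \<Rightarrow> real^'e" and j and h :: "(real^'d) \<times> (real^'e)"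
  proof -
    have r0: "0 < r k" for k using half_power_bounds(1) r by (rule order.strict_trans2)
    define y :: "nat \<Rightarrow> real^'d" where "y k = (\<chi> i. 4 * real k)" for k
    define \<tau> where "\<tau> k = (1/2::real) ^ Suc k" for k
    have \<tau>: "0 < \<tau> k" "\<tau> k \<le> 1/2" for k using half_power_bounds[of k] by (auto simp: \<tau>_def)
    define F where "F k x = c k * tile n (y k) (\<tau> k) (z k) (r k) x" for k x
    have sum_F: "tile_sum n c z r = (\<lambda>x. \<Sum>k. F k x)"
      by (simp add: fun_eq_iff tile_sum_def F_def y_def \<tau>_def)
    let ?l = "\<lambda>k. (y k - (\<chi> i. \<tau> k), z k - (\<chi> i. r k))"
    let ?u = "\<lambda>k. (y k + (\<chi> i. \<tau> k), z k + (\<chi> i. r k))"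
    have bound: "\<bar>diff_op M h (F k) x\<bar> \<le> c k * (D * (1/2) ^ ((j - k) * m))" for k x
    proof -
      have "diff_op M h (F k) x = c k * diff_op M h (tile n (y k) (\<tau> k) (z k) (r k)) x"
        unfolding F_def diff_op_def by (simp add: sum_distrib_left mult_ac)
      then show ?thesis
        using D(2)[OF h r[of k], of "y k" "z k" x] c[of k]
        unfolding \<tau>_def by (simp add: abs_mult mult_left_mono)
    qed
    have disj: "k = k'" if "x \<in> cbox (?l k) (?u k)" "x \<in> cbox (?l k') (?u k')" for k k' x
    proof -
      obtain i :: 'd where True by blast
      have "\<bar>fst x $ i - 4 * real k\<bar> \<le> \<tau> k" "\<bar>fst x $ i - 4 * real k'\<bar> \<le> \<tau> k'"
        using that unfolding cbox_Pair_eq mem_Times_iff fst_conv mem_cube by (auto simp: y_def)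
      then have "\<bar>4 * real k - 4 * real k'\<bar> \<le> 1"
        using \<tau>(2)[of k] \<tau>(2)[of k'] by linarith
      then show ?thesis by linarith
    qed
    have supp: "x \<in> cbox (?l k) (?u k)" if "F k x \<noteq> 0" for k x
      using that assms(1) \<tau>(1)[of k] r0[of k] by (intro tile_support[of n]) (auto simp: F_def)
    have term_eq: "(real M + 1) powr P * (real M + 1) * ((c k * (D * (1/2) ^ ((j - k) * m))) powr P
          * measure lborel (cbox (?l k) (?u k)))
        = W * (c k powr P * ((1/2) ^ k) ^ CARD('d) * r k ^ CARD('e) * ((1/2) ^ ((j - k) * m)) powr P)" for k
    proof -
      have "measure lborel (cbox (?l k) (?u k)) = ((1/2) ^ k) ^ CARD('d) * (2 ^ CARD('e) * r k ^ CARD('e))"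
        using \<tau>(1)[of k] r0[of k] by (subst measure_tile_support) (auto simp: \<tau>_def power_mult_distrib)
      then show ?thesis
        unfolding W_def using c[of k] D(1) by (simp add: powr_mult mult_ac)
    qed
    show ?thesis
      unfolding sum_F term_eq[symmetric]
      by (rule nn_integral_diff_op_disjoint_sum[where l = ?l and u = ?u, OF supp disj bound less_imp_le[OF assms(3)]])
  qed
  moreover have "0 \<le> W" by (simp add: W_def)
  ultimately show ?thesis using that by blast
qed

text \<open>
  On the slice, tile \<open>k\<close> has side \<open>(1/2) ^ k\<close>. From the concentric cube of half this side, a step
  of length \<open>(1/2) ^ k\<close> in one coordinate direction carries every node except the first off the tile.
  As \<open>M \<le> k\<close> keeps the whole walk no longer than \<open>1\<close>, no other tile is reached either, so the
  difference is the value of the tile up to sign.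
\<close>

lemma nn_integral_diff_op_tile_sum_slice_ge:
  fixes z :: "nat \<Rightarrow> real^'e"
  assumes "0 < n" "0 \<le> c k" "0 < r k" "M \<le> k" "\<And>i. \<bar>x'' $ i - z k $ i\<bar> \<le> r k / 2" "0 < P"
  obtains h :: "real^'d" where "norm h \<le> (1/2) ^ k"
    "ennreal ((c k * ((3/4) ^ n) ^ (CARD('d) + CARD('e))) powr P * ((1/2) ^ Suc k) ^ CARD('d))
     \<le> (\<integral>\<^sup>+x'. ennreal (\<bar>diff_op M h (\<lambda>x'. tile_sum n c z r (x', x'')) x'\<bar> powr P) \<partial>lebesgue)"
proof -
  define g where "g x' = tile_sum n c z r (x', x'')" for x' :: "real^'d"
  define \<kappa> where "\<kappa> = ((3/4::real) ^ n) ^ (CARD('d) + CARD('e))"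
  have \<kappa>: "0 < \<kappa>" by (simp add: \<kappa>_def)
  define y :: "nat \<Rightarrow> real^'d" where "y k = (\<chi> i. 4 * real k)" for k
  define \<tau> where "\<tau> k = (1/2::real) ^ Suc k" for k
  have \<tau>: "0 < \<tau> k" "\<tau> k \<le> 1/2" for k using half_power_bounds[of k] by (auto simp: \<tau>_def)
  define F where "F k x' = c k * tile n (y k) (\<tau> k) (z k) (r k) (x', x'')" for k x'
  have g_sum: "g x' = (\<Sum>k. F k x')" for x'
    by (simp add: g_def tile_sum_def F_def y_def \<tau>_def)
  have F0: "F k x' = 0" if "\<tau> k \<le> \<bar>x' $ i - 4 * real k\<bar>" for k x' i
    using box_bump_eq_0[of "\<tau> k" x' i "y k" n] that \<tau>[of k] assms(1) by (simp add: F_def tile_def y_def)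
  define t where "t = (1/2::real) ^ k"
  have t: "0 < t" "t \<le> 1" "\<tau> k = t / 2" using half_power_bounds[of k] by (auto simp: t_def \<tau>_def)
  have Mt: "real M * t \<le> 1"
  proof -
    have "real M \<le> 2 ^ k" using assms(4) of_nat_less_two_power[of k, where 'a = real] by linarith
    then have "real M * t \<le> 2 ^ k * t" using t(1) by (intro mult_right_mono) auto
    also have "\<dots> = 1" by (simp add: t_def flip: power_mult_distrib)
    finally show ?thesis .
  qed
  obtain i :: 'd where True by blast
  define h where "h = t *\<^sub>R axis i (1::real)"
  have h: "norm h \<le> t" using t by (simp add: h_def)
  define Z where "Z = cbox (y k - (\<chi> i. \<tau> k / 2)) (y k + (\<chi> i. \<tau> k / 2))"
  have Z: "\<bar>x $ i - 4 * real k\<bar> \<le> \<tau> k / 2" if "x \<in> Z" for x i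
    using that unfolding Z_def mem_cube by (simp add: y_def)
  have core: "c k * \<kappa> \<le> \<bar>diff_op M h g x\<bar>" if x: "x \<in> Z" for x
  proof -
    have g0: "g (x + real j *\<^sub>R h) = 0" if j: "j \<in> {..M} - {0}" for j
    proof -
      have "(x + real j *\<^sub>R h) $ i = x $ i + real j * t" by (simp add: h_def axis_def)
      moreover have "1 * t \<le> real j * t" "real j * t \<le> real M * t"
        using j t(1) by (auto intro!: mult_right_mono)
      ultimately have e: "3/4 * t \<le> (x + real j *\<^sub>R h) $ i - 4 * real k" "(x + real j *\<^sub>R h) $ i - 4 * real k \<le> 2"
        using Z[OF x, of i] t Mt by linarith+
      have "F k' (x + real j *\<^sub>R h) = 0" for k'
      proof (cases "k' = k")
        case True
        then show ?thesis using e(1) t by (intro F0[of _ _ i]) auto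
      next
        case False
        then have "1 \<le> \<bar>real k' - real k\<bar>" by linarith
        then show ?thesis using e t \<tau>(2)[of k'] by (intro F0[of _ _ i]) linarith
      qed
      then show ?thesis by (simp add: g_sum)
    qed
    have "F k' x = 0" if "k' \<noteq> k" for k'
    proof -
      have "1 \<le> \<bar>real k' - real k\<bar>" using that by linarith
      then show ?thesis using Z[OF x, of i] \<tau>(2)[of k'] \<tau>(2)[of k] by (intro F0[of _ _ i]) linarith
    qed
    then have "g x = F k x"
      unfolding g_sum by (subst suminf_finite[of "{k}"]) auto
    moreover have "\<kappa> \<le> tile n (y k) (\<tau> k) (z k) (r k) (x, x'')"
      unfolding tile_def \<kappa>_def prod.case power_add
      using Z[OF x] assms(3,5) \<tau>(1)[of k]
      by (intro mult_mono box_bump_ge box_bump_bounds) (auto simp: y_def)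
    ultimately have "c k * \<kappa> \<le> g x" using assms(2) by (simp add: F_def mult_left_mono)
    moreover have "diff_op M h g x = (-1) ^ M * g x"
      unfolding diff_op_def by (subst sum.remove[of _ 0]) (auto simp: g0)
    ultimately show ?thesis by (simp add: abs_mult power_abs)
  qed
  have "emeasure lebesgue Z = ennreal (measure lborel Z)"
    unfolding Z_def using emeasure_lebesgue_shift_cbox(2)[of 0] by simp
  also have "measure lborel Z = \<tau> k ^ CARD('d)"
    unfolding Z_def using \<tau>(1)[of k] by (subst measure_cube) auto
  finally have "ennreal ((c k * \<kappa>) powr P * \<tau> k ^ CARD('d)) = ennreal ((c k * \<kappa>) powr P) * emeasure lebesgue Z"
    using \<tau>(1)[of k] by (simp add: ennreal_mult)
  also have "\<dots> = (\<integral>\<^sup>+x. ennreal ((c k * \<kappa>) powr P) * indicator Z x \<partial>lebesgue)"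
    by (subst nn_integral_cmult_indicator) (auto simp: Z_def)
  also have "\<dots> \<le> (\<integral>\<^sup>+x. ennreal (\<bar>diff_op M h g x\<bar> powr P) \<partial>lebesgue)"
    using core assms(2,6) \<kappa>
    by (intro nn_integral_mono) (auto simp: indicator_def intro!: ennreal_leI powr_mono2)
  finally show ?thesis
    using that[of h] h unfolding g_def[abs_def] \<kappa>_def t_def \<tau>_def by blast
qed

section \<open>Smooth functions with rough slices\<close>

theorem theorem6p1:
  fixes p q :: ennreal and s :: real and \<Psi> :: "real \<Rightarrow> real"
  assumes "0 < p" and "p < q"
    and "sigma_exp (CARD('d::finite) + CARD('e::finite)) p < s"
    and "admissible \<Psi>"
  shows "\<exists>f :: (real^'d) \<times> (real^'e) \<Rightarrow> real.
           (\<forall>M. s < real M \<longrightarrow> f \<in> besov_space M p q s \<Psi>) \<and>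
           (AE x'' in lebesgue. \<forall>M. s < real M \<longrightarrow>
              (\<lambda>x'. f (x', x'')) \<notin> besov_space M p \<infinity> s \<Psi>)"
proof -
  have "0 \<le> sigma_exp (CARD('d) + CARD('e)) p" by (simp add: sigma_exp_def)
  then have s: "0 < s" using assms(3) by linarith
  define P where "P = enn2real p"
  have pfin: "p \<noteq> \<infinity>" using assms(2) by auto
  have pP: "p = ennreal P" using pfin by (simp add: P_def less_top)
  have P: "0 < P" using assms(1) pfin by (simp add: P_def enn2real_positive_iff less_top)
  \<comment> \<open>For \<open>q = \<infinity>\<close> any finite exponent above \<open>p\<close> serves: summability of \<open>T\<close> is then only
    used through boundedness.\<close>
  define Q where "Q = (if q = \<infinity> then P + 1 else enn2real q)"
  have PQ: "P < Q"
    using assms(2) P unfolding Q_def pP by (cases q) (auto simp: ennreal_less_iff)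
  have q0: "0 < q" using assms(1,2) by (rule order.strict_trans)
  \<comment> \<open>The least order of differences in question; tiles need only that much smoothness.\<close>
  define m where "m = nat \<lfloor>s\<rfloor> + 1"
  have m: "s < real m" using s by (simp add: m_def) linarith
  have m_le: "m \<le> M" if "s < real M" for M
    using that s unfolding m_def by linarith
  define n where "n = m + 1"
  obtain a r :: "nat \<Rightarrow> real" and z :: "nat \<Rightarrow> real^'e" where
    a: "\<And>k. 0 \<le> a k" and r: "\<And>k. (1/2) ^ k \<le> r k" and
    summ: "summable (\<lambda>k. (a k powr P * r k ^ CARD('e)) powr (Q / P))" and
    cover: "\<And>x A n. \<exists>k\<ge>n. A \<le> a k \<and> (\<forall>i. \<bar>x $ i - z k $ i\<bar> \<le> r k / 2)"
    using recurrent_covering[OF P PQ, where 'e = 'e] by blast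
  have r0: "0 < r k" for k using half_power_bounds(1) r by (rule order.strict_trans2)
  define B where "B k = a k powr P * r k ^ CARD('e)" for k
  have B0: "0 \<le> B k" for k using r0[of k] by (simp add: B_def)
  define v where "v k = 2 powr (- s * k) / \<Psi> ((1/2) ^ k)" for k :: nat
  have \<psi>: "0 < \<Psi> ((1/2) ^ k)" for k :: nat
    by (rule admissible_pos[OF assms(4) half_power_bounds])
  have v: "0 < v k" for k using \<psi>[of k] by (simp add: v_def)
  obtain T E where T: "\<And>j. 0 \<le> T j" "summable T" and E: "0 \<le> E" and
    TE: "\<And>j. (\<Sum>k. ennreal (B k * (v k * (1/2) ^ ((j - k) * m)) powr P))
        \<le> ennreal ((E * v j * T j powr (1 / Q)) powr P)"
    using weighted_sum_bound[OF assms(4) s m P PQ B0 summ[folded B_def]] unfolding v_def by blast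
  \<comment> \<open>The last factor cancels the \<open>L\<^sup>p\<close> size \<open>2 powr (- (k * d / p))\<close> of a slice of tile \<open>k\<close>, and
    \<open>v k\<close> the Besov weight at scale \<open>(1/2) ^ k\<close>; what remains of the slice seminorm is \<open>a k\<close>.\<close>
  define c where "c k = a k * v k * 2 powr (real k * CARD('d) / P)" for k
  have c: "0 \<le> c k" for k using a[of k] v[of k] by (simp add: c_def)
  have cB: "c k powr P * ((1/2) ^ k) ^ CARD('d) * r k ^ CARD('e) * w powr P = B k * (v k * w) powr P"
    if "0 \<le> w" for k w
  proof -
    have "(2 powr (real k * CARD('d) / P)) powr P * ((1/2) ^ k) ^ CARD('d) = 1"
      unfolding half_power_eq_powr powr_powr using P
      by (simp add: powr_power powr_add[symmetric] mult.commute)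
    then have "c k powr P * ((1/2) ^ k) ^ CARD('d) = a k powr P * v k powr P"
      unfolding c_def using a[of k] v[of k] by (simp add: powr_mult)
    then show ?thesis using that v[of k] by (simp add: B_def powr_mult mult_ac)
  qed
  define f :: "(real^'d) \<times> (real^'e) \<Rightarrow> real" where "f = tile_sum n c z r"

  \<comment> \<open>Besides the order \<open>m\<close>, the order \<open>0\<close> at scale \<open>1\<close> is admitted: it gives \<open>f \<in> L\<^sup>p\<close>.\<close>
  have upper: "\<exists>D\<ge>0. \<forall>j h. norm h \<le> (1/2) ^ j \<longrightarrow> (m' = m \<or> j = 0) \<longrightarrow>
      Lp_norm p (diff_op M h f) \<le> ennreal (D * v j * T j powr (1 / Q))" if m': "m' < n" "m' \<le> M" for M m'
  proof -
    obtain W where W: "0 \<le> W" and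
      est: "\<And>c r (z :: nat \<Rightarrow> real^'e) j (h :: (real^'d) \<times> (real^'e)).
       (\<And>k. 0 \<le> c k) \<Longrightarrow> (\<And>k. (1/2) ^ k \<le> r k) \<Longrightarrow> norm h \<le> (1/2) ^ j \<Longrightarrow>
       (\<integral>\<^sup>+x. ennreal (\<bar>diff_op M h (tile_sum n c z r) x\<bar> powr P) \<partial>lebesgue)
       \<le> (\<Sum>k. ennreal (W * (c k powr P * ((1/2) ^ k) ^ CARD('d) * r k ^ CARD('e)
              * ((1/2) ^ ((j - k) * m')) powr P)))"
      using nn_integral_diff_op_tile_sum[OF m' P, where 'd = 'd and 'e = 'e] by blast
    have "Lp_norm p (diff_op M h f) \<le> ennreal (W powr (1 / P) * E * v j * T j powr (1 / Q))"
      if h: "norm h \<le> (1/2) ^ j" and j: "m' = m \<or> j = 0" for j h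
    proof -
      have exps: "(j - k) * m' = (j - k) * m" for k using j by auto
      have "(\<integral>\<^sup>+x. ennreal (\<bar>diff_op M h f x\<bar> powr P) \<partial>lebesgue)
          \<le> (\<Sum>k. ennreal (W * (B k * (v k * (1/2) ^ ((j - k) * m)) powr P)))"
        unfolding f_def using est[where c = c and r = r and z = z, OF c r h] by (simp add: exps cB)
      also have "\<dots> = ennreal W * (\<Sum>k. ennreal (B k * (v k * (1/2) ^ ((j - k) * m)) powr P))"
        using W B0 by (simp add: ennreal_mult)
      also have "\<dots> \<le> ennreal W * ennreal ((E * v j * T j powr (1 / Q)) powr P)"
        by (intro mult_left_mono TE) simp
      also have "\<dots> = ennreal ((W powr (1 / P) * E * v j * T j powr (1 / Q)) powr P)"
        using W E v[of j] P by (simp add: ennreal_mult[symmetric] powr_mult powr_powr mult_ac)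
      finally show ?thesis unfolding pP using P E v[of j] by (intro Lp_norm_le) auto
    qed
    moreover have "0 \<le> W powr (1 / P) * E" using E by simp
    ultimately show ?thesis by blast
  qed

  have "Lp_norm p f < \<infinity>"
  proof -
    obtain D where D: "\<And>j h. norm h \<le> (1/2) ^ j \<Longrightarrow> 0 = m \<or> j = 0 \<Longrightarrow>
        Lp_norm p (diff_op 0 h f) \<le> ennreal (D * v j * T j powr (1 / Q))"
      using upper[of 0 0] by (auto simp: n_def)
    have "diff_op 0 0 f = f" by (simp add: diff_op_def fun_eq_iff)
    then have "Lp_norm p f \<le> ennreal (D * v 0 * T 0 powr (1 / Q))" using D[of 0 0] by simp
    then show ?thesis by (rule order.strict_trans1) simp
  qed
  then have fLp: "f \<in> Lp_space p"
    by (simp add: Lp_space_def measurable_completion f_def tile_sum_measurable)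
  have fB: "f \<in> besov_space M p q s \<Psi>" if M: "s < real M" for M
  proof -
    obtain D where D: "0 \<le> D" "\<And>j h. norm h \<le> (1/2) ^ j \<Longrightarrow>
        Lp_norm p (diff_op M h f) \<le> ennreal (D * v j * T j powr (1 / Q))"
      using upper[of m M] m_le[OF M] by (auto simp: n_def)
    have w: "2 powr (s * j) * \<Psi> ((1/2) ^ j) * (D * v j * T j powr (1 / Q)) = D * T j powr (1 / Q)" for j :: nat
      using \<psi>[of j] by (simp add: v_def powr_minus field_simps)
    obtain X where X: "\<And>j. T j \<le> X"
      using summable_imp_bounded[OF T(2)] by (metis bounded_real abs_le_D1 rangeI)
    have "besov_seminorm M p q s \<Psi> f < \<infinity>"
    proof (rule besov_seminorm_finite[OF assms(4) less_imp_le[OF s] q0 _ D(2)])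
      show "0 \<le> D * v j * T j powr (1 / Q)" for j using D(1) v[of j] by simp
      show "2 powr (s * j) * \<Psi> ((1/2) ^ j) * (D * v j * T j powr (1 / Q)) \<le> D * X powr (1 / Q)" for j :: nat
        unfolding w using D(1) X[of j] T(1)[of j] P PQ by (intro mult_left_mono powr_mono2) auto
      assume "q \<noteq> \<infinity>"
      then have "enn2real q = Q" by (simp add: Q_def)
      then have "(D * T j powr (1 / Q)) powr enn2real q = D powr Q * T j" for j
        using D(1) T(1)[of j] P PQ by (simp add: powr_mult powr_powr)
      then show "summable (\<lambda>j. (2 powr (s * real j) * \<Psi> ((1/2) ^ j) * (D * v j * T j powr (1 / Q))) powr enn2real q)"
        unfolding w using T(2) by (simp add: summable_mult)
    qed
    with fLp show ?thesis by (simp add: besov_space_def)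
  qed

  have lower: "besov_seminorm M p \<infinity> s \<Psi> (\<lambda>x'. f (x', x'')) = \<infinity>" for M x''
  proof -
    define g where "g = (\<lambda>x'. f (x', x''))"
    define \<kappa> where "\<kappa> = ((3/4::real) ^ n) ^ (CARD('d) + CARD('e))"
    have \<kappa>: "0 < \<kappa>" by (simp add: \<kappa>_def)
    define \<kappa>' where "\<kappa>' = \<kappa> * 2 powr (- (CARD('d) / P))"
    have \<kappa>': "0 < \<kappa>'" using \<kappa> by (simp add: \<kappa>'_def)
    have large: "ennreal A \<le> besov_seminorm M p \<infinity> s \<Psi> g" for A
    proof -
      obtain k where k: "M \<le> k" "A / \<kappa>' \<le> a k" "\<And>i. \<bar>x'' $ i - z k $ i\<bar> \<le> r k / 2"
        using cover[of M "A / \<kappa>'" x''] by blast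
      define t where "t = (1/2::real) ^ k"
      have t: "0 < t" "t \<le> 1" using half_power_bounds[of k] by (auto simp: t_def)
      define \<tau> where "\<tau> = (1/2::real) ^ Suc k"
      have \<tau>: "0 < \<tau>" unfolding \<tau>_def by (rule half_power_bounds)
      have "0 < n" by (simp add: n_def)
      then obtain h where h: "norm h \<le> t" and
        int_ge: "ennreal ((c k * \<kappa>) powr P * \<tau> ^ CARD('d))
          \<le> (\<integral>\<^sup>+x'. ennreal (\<bar>diff_op M h g x'\<bar> powr P) \<partial>lebesgue)"
        using nn_integral_diff_op_tile_sum_slice_ge[where 'd = 'd, of n c k r M x'' z P] c[of k] r0[of k] k(1,3) P
        unfolding t_def \<tau>_def \<kappa>_def g_def f_def by blast
      define G where "G = c k * \<kappa> * \<tau> powr (CARD('d) / P)"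
      have G0: "0 \<le> G" using c[of k] \<kappa> by (simp add: G_def)
      have "G powr P = (c k * \<kappa>) powr P * \<tau> ^ CARD('d)"
        using c[of k] \<kappa> \<tau> P by (simp add: G_def powr_mult powr_powr powr_realpow)
      then have "ennreal G \<le> Lp_norm p (diff_op M h g)"
        unfolding pP using P G0 int_ge by (intro Lp_norm_ge) auto
      then have "ennreal (t powr (- s) * \<Psi> t) * ennreal G \<le> besov_seminorm M p \<infinity> s \<Psi> g"
        using t h by (intro besov_seminorm_infinity_ge)
      moreover have "t powr (- s) * \<Psi> t * G = a k * \<kappa>'"
      proof -
        have 1: "t powr (- s) = 2 powr (s * k)"
          unfolding t_def half_power_eq_powr powr_powr by (simp add: mult.commute)
        have 2: "2 powr (real k * CARD('d) / P) * \<tau> powr (CARD('d) / P) = 2 powr (- (CARD('d) / P))"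
        proof -
          have "real k * CARD('d) / P + - real (Suc k) * (CARD('d) / P) = - (CARD('d) / P)"
            using P by (simp add: field_simps)
          then show ?thesis
            unfolding \<tau>_def half_power_eq_powr powr_powr powr_add[symmetric] by (simp only:)
        qed
        have 3: "2 powr (s * k) * \<Psi> t * v k = 1"
          using \<psi>[of k] by (simp add: v_def t_def powr_minus)
        have "t powr (- s) * \<Psi> t * G = a k * \<kappa> * (2 powr (s * k) * \<Psi> t * v k)
            * (2 powr (real k * CARD('d) / P) * \<tau> powr (CARD('d) / P))"
          unfolding 1 G_def c_def by (simp add: mult_ac)
        then show ?thesis unfolding 2 3 \<kappa>'_def by simp
      qed
      moreover have "ennreal A \<le> ennreal (a k * \<kappa>')"
        using k(2) \<kappa>' by (intro ennreal_leI) (simp add: pos_divide_le_eq)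
      ultimately show ?thesis
        using G0 by (auto simp: ennreal_mult''[symmetric] intro: order_trans)
    qed
    have "besov_seminorm M p \<infinity> s \<Psi> g = \<infinity>"
    proof (rule ccontr)
      assume "besov_seminorm M p \<infinity> s \<Psi> g \<noteq> \<infinity>"
      then obtain b where "besov_seminorm M p \<infinity> s \<Psi> g = ennreal b" "0 \<le> b"
        by (cases "besov_seminorm M p \<infinity> s \<Psi> g") auto
      then show False using large[of "b + 1"] by simp
    qed
    then show ?thesis by (simp add: g_def)
  qed
  have "AE x'' in lebesgue. \<forall>M. s < real M \<longrightarrow> (\<lambda>x'. f (x', x'')) \<notin> besov_space M p \<infinity> s \<Psi>"
    using lower by (intro AE_I2) (simp add: besov_space_def)
  with fB show ?thesis by blast
qed

end
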